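(* Let $d\geq 1$ and let $\Pi := \{A,B\}$ be a partition of $[2d]$ into two sets with $d$ elements each. (1) If $\mathcal{P}$ and $\mathcal{Q}$ are two-image portraits with $\Pi_{\mathcal{P}} = \Pi_{\mathcal{Q}} = \Pi$, then $\mathrm{Conf}_{\mathcal{P},d} = \mathrm{Conf}_{\mathcal{Q},d}$. Hence $\mathrm{Conf}_{\mathcal{P},d}$ depends only on the partition $\Pi$; let $\mathrm{Conf}_{\Pi,d} := \mathrm{Conf}_{\mathcal{P},d}$ and $\mathcal{M}_{\Pi,d} := \mathrm{Conf}_{\Pi,d}/\mathrm{Aff}_1$. Thus $\mathcal{M}_{\mathcal{P},\mathcal{Q},d} = \mathcal{M}_{\Pi,d}$. (2) $\mathrm{Conf}_{\Pi,d}$ is the $(d+1)$-dimensional Zariski closed subspace of $\mathrm{Conf}^{2d}$ defined by the equations $e_k(x_A) = e_k(x_B)$ for $1\leq k < d$, where $e_k$ is the $k$th elementary symmetric function in $d$ variables, $x_A := \{x_a : a \in A\}$ is the subset of the coordinate variables $\{x_1, \ldots, x_{2d}\}$ indexed by $A$, and likewise for $x_B$. (3) If $\Pi' \neq \Pi$ is any other partition of $[2d]$ into two sets of $d$ elements each and $K$ is a field of characteristic $0$, then $\mathrm{Conf}_{\Pi,d}(K) \cap \mathrm{Conf}_{\Pi',d}(K) = \emptyset$. Equivalently, if $\mathcal{P}$ and $\mathcal{Q}$ are two-image portraits on $[2d]$ with distinct fiber partitions, then $\mathcal{M}_{\mathcal{P},\mathcal{Q},d}(K) = \emptyset$. (4)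 For each $q \in \mathrm{Conf}_{\Pi,d}$, $\mathrm{End}(q)$ contains at least $2d(2d - 1)$ degree-$d$ endomorphisms of $q$. Hence $E_{2d,d} \geq 2d(2d - 1)$.
   Context: Work over an arbitrary base field except where a field is specified; when no field of definition is indicated, points are geometric points (over an algebraic closure of the base field). $[n] := \{1,\ldots,n\}$; a portrait on $[n]$ is a function $\mathcal{P}:[n]\to[n]$. Its fiber partition is the partition $\Pi_{\mathcal{P}} := \{\mathcal{P}^{-1}(i) : i\in \mathcal{P}([n])\}$ of $[n]$. A two-image portrait is a portrait $\mathcal{P}:[2d]\to[2d]$ such that $\Pi_{\mathcal{P}}$ consists of two sets with $d$ elements each. $\mathrm{Conf}^n := \{(q_1,\ldots,q_n)\in\mathbb{A}^n : q_i\neq q_j \text{ for } i\neq j\}$. $\mathrm{Conf}_{\mathcal{P},d}$ is the set (subvariety) of $q\in\mathrm{Conf}^n$ for which there exists a polynomial $f$ of degree exactly $d$ with $f(q_i)=q_{\mathcal{P}(i)}$ for all $i$. The group $\mathrm{Aff}_1$ of polynomials $\ell(x)=ax+b$, $a\ne0$, acts coordinatewise on $\mathrm{Conf}^n$ and stabilizes $\mathrm{Conf}_{\mathcal{P},d}$; $\mathcal{M}_{\mathcal{P},\mathcal{Q},d} := (\mathrm{Conf}_{\mathcal{P},d}\cap\mathrm{Conf}_{\mathcal{Q},d})/\mathrm{Aff}_1$ (for $n\geq 2$ such a quotient is identified with the locus $q_1=0$, $q_2=1$). For $q\in\mathrm{Conf}^n$, $\mathrm{End}(q)$ is the semigroup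 of all polynomials $f$ with $f(\{q_1,\ldots,q_n\})\subseteq\{q_1,\ldots,q_n\}$, $\mathrm{End}_d(q)$ is its subset of polynomials of degree exactly $d$, and for $0\le d\le n-1$, $E_{n,d}$ is the maximal cardinality of $\mathrm{End}_d(q)$ as $q$ ranges over $\mathrm{Conf}^n$. *)

theory Defs
  imports
    "HOL-Analysis.Abstract_Topology"
    "HOL-Library.FuncSet"
    "HOL-Library.Disjoint_Sets"
    "HOL-Library.Extended_Nat"
    "HOL-Algebra.Algebraic_Closure_Type"
begin

section \<open>Zariski topology and dimension\<close>

text \<open>
  Points of affine \<open>n\<close>-space are functions on \<open>{1..n}\<close>, extended by \<^const>\<open>undefined\<close> outside.
\<close>

abbreviation affine_space :: "nat \<Rightarrow> (nat \<Rightarrow> 'a::field) set" where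
  "affine_space n \<equiv> {1..n} \<rightarrow>\<^sub>E UNIV"

text \<open>
  The functions induced by polynomials in the coordinates \<open>x 1, \<dots>, x n\<close>.  Only zero sets matter
  below, so there is no need to distinguish polynomials from the functions that they induce.
\<close>

inductive_set poly_funs :: "nat \<Rightarrow> ((nat \<Rightarrow> 'a::field) \<Rightarrow> 'a) set" for n where
  const: "(\<lambda>x. c) \<in> poly_funs n"
| coord: "i \<in> {1..n} \<Longrightarrow> (\<lambda>x. x i) \<in> poly_funs n"
| add: "f \<in> poly_funs n \<Longrightarrow> g \<in> poly_funs n \<Longrightarrow> (\<lambda>x. f x + g x) \<in> poly_funs n"
| mult: "f \<in> poly_funs n \<Longrightarrow> g \<in> poly_funs n \<Longrightarrow> (\<lambda>x. f x * g x) \<in> poly_funs n"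

definition zero_locus :: "nat \<Rightarrow> ((nat \<Rightarrow> 'a::field) \<Rightarrow> 'a) set \<Rightarrow> (nat \<Rightarrow> 'a) set" where
  "zero_locus n F = {x \<in> affine_space n. \<forall>f\<in>F. f x = 0}"

definition zariski :: "nat \<Rightarrow> (nat \<Rightarrow> 'a::field) topology" where
  "zariski n = topology (\<lambda>U. \<exists>F \<subseteq> poly_funs n. U = affine_space n - zero_locus n F)"

lemma istopology_zariski:
  "istopology (\<lambda>U. \<exists>F \<subseteq> poly_funs n. U = affine_space n - zero_locus n F)"
  unfolding istopology_def
proof (intro conjI allI impI)
  fix S T :: "(nat \<Rightarrow> 'a) set"
  assume "\<exists>F \<subseteq> poly_funs n. S = affine_space n - zero_locus n F"
    and "\<exists>F \<subseteq> poly_funs n. T = affine_space n - zero_locus n F"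
  then obtain F G where F: "F \<subseteq> poly_funs n" "S = affine_space n - zero_locus n F"
    and G: "G \<subseteq> poly_funs n" "T = affine_space n - zero_locus n G" by blast
  let ?H = "{\<lambda>x. f x * g x | f g. f \<in> F \<and> g \<in> G}"
  have "?H \<subseteq> poly_funs n" using F(1) G(1) by (auto intro!: poly_funs.mult)
  moreover have "S \<inter> T = affine_space n - zero_locus n ?H"
  proof (rule Set.set_eqI)
    fix x
    have "(\<forall>h\<in>?H. h x = 0) \<longleftrightarrow> (\<forall>f g. f \<in> F \<and> g \<in> G \<longrightarrow> f x * g x = 0)"
    proof
      assume H: "\<forall>h\<in>?H. h x = 0"
      show "\<forall>f g. f \<in> F \<and> g \<in> G \<longrightarrow> f x * g x = 0"
      proof (intro allI impI)
        fix f g assume "f \<in> F \<and> g \<in> G"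
        then have "(\<lambda>x. f x * g x) \<in> ?H" by blast
        from bspec[OF H this] show "f x * g x = 0" .
      qed
    qed auto
    also have "\<dots> \<longleftrightarrow> (\<forall>f\<in>F. f x = 0) \<or> (\<forall>g\<in>G. g x = 0)" unfolding mult_eq_0_iff by blast
    finally have "x \<in> zero_locus n ?H \<longleftrightarrow>
        x \<in> affine_space n \<and> ((\<forall>f\<in>F. f x = 0) \<or> (\<forall>g\<in>G. g x = 0))"
      unfolding zero_locus_def by simp
    then show "x \<in> S \<inter> T \<longleftrightarrow> x \<in> affine_space n - zero_locus n ?H"
      unfolding F(2) G(2) Int_iff Diff_iff zero_locus_def mem_Collect_eq by argo
  qed
  ultimately show "\<exists>F \<subseteq> poly_funs n. S \<inter> T = affine_space n - zero_locus n F" by blast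
next
  fix \<K> :: "(nat \<Rightarrow> 'a) set set"
  assume "\<forall>K\<in>\<K>. \<exists>F \<subseteq> poly_funs n. K = affine_space n - zero_locus n F"
  from bchoice[OF this] obtain F where
    F: "\<forall>K\<in>\<K>. F K \<subseteq> poly_funs n \<and> K = affine_space n - zero_locus n (F K)" ..
  have "(\<Union>K\<in>\<K>. F K) \<subseteq> poly_funs n" using F by blast
  moreover have "\<Union>\<K> = affine_space n - zero_locus n (\<Union>K\<in>\<K>. F K)"
  proof -
    have "(\<Union>K\<in>\<K>. K) = (\<Union>K\<in>\<K>. affine_space n - zero_locus n (F K))"
      by (rule SUP_cong[OF refl]) (rule F[rule_format, THEN conjunct2])
    also have "\<dots> = affine_space n - zero_locus n (\<Union>K\<in>\<K>. F K)"
      unfolding zero_locus_def by blast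
    finally show ?thesis by simp
  qed
  ultimately show "\<exists>F \<subseteq> poly_funs n. \<Union>\<K> = affine_space n - zero_locus n F" by blast
qed

lemma openin_zariski:
  "openin (zariski n) U \<longleftrightarrow> (\<exists>F \<subseteq> poly_funs n. U = affine_space n - zero_locus n F)"
  unfolding zariski_def topology_inverse'[OF istopology_zariski] ..

lemma topspace_zariski [simp]: "topspace (zariski n) = affine_space n"
proof -
  have "openin (zariski n) (affine_space n)"
    unfolding openin_zariski
    by (intro exI[of _ "{\<lambda>x. 1}"]) (auto simp: zero_locus_def intro: poly_funs.const)
  moreover have "U \<subseteq> affine_space n" if "openin (zariski n) U" for U :: "(nat \<Rightarrow> 'a) set"
    using that unfolding openin_zariski by blast
  ultimately show ?thesis
    unfolding topspace_def by blast
qed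

lemma closedin_zariski: "closedin (zariski n) Z \<longleftrightarrow> (\<exists>F \<subseteq> poly_funs n. Z = zero_locus n F)"
proof -
  have sub: "zero_locus n F \<subseteq> affine_space n" for F :: "((nat \<Rightarrow> 'a) \<Rightarrow> 'a) set"
    unfolding zero_locus_def by (rule Collect_restrict)
  have "closedin (zariski n) Z \<longleftrightarrow> Z \<subseteq> affine_space n \<and>
      (\<exists>F \<subseteq> poly_funs n. affine_space n - Z = affine_space n - zero_locus n F)"
    unfolding closedin_def openin_zariski topspace_zariski ..
  also have "\<dots> \<longleftrightarrow> (\<exists>F \<subseteq> poly_funs n. Z = zero_locus n F)"
    using sub double_diff[OF _ order_refl, of _ "affine_space n :: (nat \<Rightarrow> 'a) set"] by metis
  finally show ?thesis .
qed

definition irreducible_space :: "'a topology \<Rightarrow> bool" where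
  "irreducible_space T \<longleftrightarrow> topspace T \<noteq> {} \<and>
     (\<forall>C D. closedin T C \<and> closedin T D \<and> C \<union> D = topspace T \<longrightarrow> C = topspace T \<or> D = topspace T)"

text \<open>
  The dimension of a topological space: the supremum of the lengths \<open>m\<close> of chains
  \<open>Z 0 \<subset> \<dots> \<subset> Z m\<close> of irreducible closed subsets (for the empty space it is 0 here).
\<close>

definition krull_dim :: "'a topology \<Rightarrow> enat" where
  "krull_dim T = Sup {enat m | m. \<exists>Z :: nat \<Rightarrow> 'a set.
     (\<forall>i\<le>m. closedin T (Z i) \<and> irreducible_space (subtopology T (Z i))) \<and>
     (\<forall>i<m. Z i \<subset> Z (Suc i))}"


section \<open>Portraits and configurations\<close>

definition is_portrait :: "nat \<Rightarrow> (nat \<Rightarrow> nat) \<Rightarrow> bool" where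
  "is_portrait n P \<longleftrightarrow> P \<in> {1..n} \<rightarrow> {1..n}"

definition fiber_partition :: "nat \<Rightarrow> (nat \<Rightarrow> nat) \<Rightarrow> nat set set" where
  "fiber_partition n P = {{j \<in> {1..n}. P j = i} | i. i \<in> P ` {1..n}}"

definition half_partition :: "nat \<Rightarrow> nat set set \<Rightarrow> bool" where
  "half_partition d \<pi> \<longleftrightarrow> partition_on {1..2*d} \<pi> \<and> card \<pi> = 2 \<and> (\<forall>S\<in>\<pi>. card S = d)"

definition two_image_portrait :: "nat \<Rightarrow> (nat \<Rightarrow> nat) \<Rightarrow> bool" where
  "two_image_portrait d P \<longleftrightarrow> is_portrait (2*d) P \<and> half_partition d (fiber_partition (2*d) P)"

text \<open>
  The sets below are defined for any field of coordinates.  For an algebraically closed field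
  they are the sets of geometric points.
\<close>

definition Conf :: "nat \<Rightarrow> (nat \<Rightarrow> 'a::field) set" where
  "Conf n = {q \<in> affine_space n. inj_on q {1..n}}"

definition Conf_portrait :: "nat \<Rightarrow> (nat \<Rightarrow> nat) \<Rightarrow> nat \<Rightarrow> (nat \<Rightarrow> 'a::field) set" where
  "Conf_portrait n P d =
     {q \<in> Conf n. \<exists>f :: 'a poly. Polynomial.degree f = d \<and> (\<forall>i\<in>{1..n}. poly f (q i) = q (P i))}"

text \<open>Independence of the chosen portrait is part of the theorem.\<close>

definition Conf_partition :: "nat set set \<Rightarrow> nat \<Rightarrow> (nat \<Rightarrow> 'a::field) set" where
  "Conf_partition \<pi> d =
     Conf_portrait (2*d) (SOME P. two_image_portrait d P \<and> fiber_partition (2*d) P = \<pi>) d"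

definition elem_sym :: "nat \<Rightarrow> nat set \<Rightarrow> (nat \<Rightarrow> 'a::field) \<Rightarrow> 'a" where
  "elem_sym k A x = (\<Sum>S | S \<subseteq> A \<and> card S = k. \<Prod>a\<in>S. x a)"


section \<open>Quotients by the affine group\<close>

definition aff_orbit :: "nat \<Rightarrow> (nat \<Rightarrow> 'a::field) \<Rightarrow> (nat \<Rightarrow> 'a) set" where
  "aff_orbit n q = {(\<lambda>i\<in>{1..n}. a * q i + b) | a b. a \<noteq> 0}"

definition aff_quotient :: "nat \<Rightarrow> (nat \<Rightarrow> 'a::field) set \<Rightarrow> (nat \<Rightarrow> 'a) set set" where
  "aff_quotient n V = aff_orbit n ` V"

definition Moduli_portraits ::
    "nat \<Rightarrow> (nat \<Rightarrow> nat) \<Rightarrow> (nat \<Rightarrow> nat) \<Rightarrow> nat \<Rightarrow> (nat \<Rightarrow> 'a::field) set set" where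
  "Moduli_portraits n P Q d = aff_quotient n (Conf_portrait n P d \<inter> Conf_portrait n Q d)"

definition Moduli_partition :: "nat set set \<Rightarrow> nat \<Rightarrow> (nat \<Rightarrow> 'a::field) set set" where
  "Moduli_partition \<pi> d = aff_quotient (2*d) (Conf_partition \<pi> d)"


section \<open>Rational points\<close>

definition base_change :: "nat \<Rightarrow> (nat \<Rightarrow> 'k::field) \<Rightarrow> (nat \<Rightarrow> 'k alg_closure)" where
  "base_change n r = (\<lambda>i\<in>{1..n}. to_ac (r i))"

text \<open>The \<open>K\<close>-points of a variety that is given by its set of geometric points.\<close>

definition rat_points :: "nat \<Rightarrow> (nat \<Rightarrow> 'k::field alg_closure) set \<Rightarrow> (nat \<Rightarrow> 'k) set" where
  "rat_points n V = {r \<in> affine_space n. base_change n r \<in> V}"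

text \<open>
  The \<open>K\<close>-points of a quotient by the affine group.  For \<open>n \<ge> 2\<close> the quotient is identified with
  the locus \<open>q 1 = 0\<close>, \<open>q 2 = 1\<close>; a point of it is \<open>K\<close>-rational if its representative in this
  locus has coordinates in \<open>K\<close>.
\<close>

definition rat_orbits ::
    "nat \<Rightarrow> (nat \<Rightarrow> 'k::field alg_closure) set set \<Rightarrow> (nat \<Rightarrow> 'k alg_closure) set set" where
  "rat_orbits n M =
     {C \<in> M. \<exists>r\<in>affine_space n. r 1 = (0::'k) \<and> r 2 = 1 \<and> base_change n r \<in> C}"


section \<open>Endomorphisms of a configuration\<close>

definition End_conf :: "nat \<Rightarrow> (nat \<Rightarrow> 'a::field) \<Rightarrow> 'a poly set" where
  "End_conf n q = {f. poly f ` (q ` {1..n}) \<subseteq> q ` {1..n}}"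

definition End_deg :: "nat \<Rightarrow> nat \<Rightarrow> (nat \<Rightarrow> 'a::field) \<Rightarrow> 'a poly set" where
  "End_deg n d q = {f \<in> End_conf n q. Polynomial.degree f = d}"

text \<open>
  The maximal number of degree \<open>d\<close> endomorphisms of a configuration of \<open>n\<close> points with
  coordinates in \<open>'a\<close>; meaningful for \<open>d < n\<close>, by the two finiteness facts below.
\<close>

definition max_End :: "'a::field itself \<Rightarrow> nat \<Rightarrow> nat \<Rightarrow> nat" where
  "max_End _ n d = Max ((\<lambda>q. card (End_deg n d q)) ` (Conf n :: (nat \<Rightarrow> 'a) set))"

lemma End_deg_bound:
  fixes q :: "nat \<Rightarrow> 'a::field"
  assumes "q \<in> Conf n" "d < n"
  shows "finite (End_deg n d q)" "card (End_deg n d q) \<le> n ^ n"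
proof -
  let ?X = "q ` {1..n}"
  let ?r = "\<lambda>f :: 'a poly. restrict (poly f) ?X"
  have card: "card ?X = n" using assms(1) by (simp add: Conf_def card_image)
  have inj: "inj_on ?r (End_deg n d q)"
  proof (rule inj_onI)
    fix f g assume fg: "f \<in> End_deg n d q" "g \<in> End_deg n d q" "?r f = ?r g"
    show "f = g"
    proof (rule poly_eqI_degree[of ?X])
      show "poly f x = poly g x" if "x \<in> ?X" for x
        using fun_cong[OF fg(3), of x] that by simp
    qed (use fg(1,2) assms(2) card in \<open>simp_all add: End_deg_def\<close>)
  qed
  have sub: "?r ` End_deg n d q \<subseteq> ?X \<rightarrow>\<^sub>E ?X"
    unfolding End_deg_def End_conf_def by (intro image_subsetI restrict_PiE_iff[THEN iffD2]) blast
  have fin: "finite (?X \<rightarrow>\<^sub>E ?X)" by (intro finite_PiE) simp_all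
  show "finite (End_deg n d q)"
    using inj sub fin by (meson finite_imageD finite_subset)
  have "card (End_deg n d q) \<le> card (?X \<rightarrow>\<^sub>E ?X)"
    using card_mono[OF fin sub] card_image[OF inj] by simp
  then show "card (End_deg n d q) \<le> n ^ n"
    using card by (simp add: card_PiE)
qed

lemma finite_End_counts:
  assumes "d < n"
  shows "finite ((\<lambda>q. card (End_deg n d q)) ` (Conf n :: (nat \<Rightarrow> 'a::field) set))"
proof (rule finite_subset)
  show "(\<lambda>q. card (End_deg n d q)) ` (Conf n :: (nat \<Rightarrow> 'a) set) \<subseteq> {..n ^ n}"
    unfolding image_subset_iff atMost_iff using End_deg_bound(2)[OF _ assms] by (intro ballI)
qed (rule finite_atMost)

end

theory Submission
  imports Defs "HOL-Combinatorics.Permutations"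
begin

text \<open>
  Let \<open>g\<^sub>A\<close> and \<open>g\<^sub>B\<close> be the monic polynomials with roots \<open>q\<^sub>a\<close> (\<open>a \<in> A\<close>) and \<open>q\<^sub>b\<close> (\<open>b \<in> B\<close>).  If a polynomial
  \<open>f\<close> of degree \<open>d\<close> takes two distinct constant values \<open>u\<close> on the first set and \<open>v\<close> on the second, then
  \<open>f - u\<close> and \<open>f - v\<close> are the same multiple of \<open>g\<^sub>A\<close> and \<open>g\<^sub>B\<close>, so \<open>g\<^sub>A - g\<^sub>B\<close> is constant; conversely,
  if \<open>g\<^sub>A - g\<^sub>B\<close> is a constant, an affine function of \<open>g\<^sub>A\<close> takes any two prescribed values
  (\<open>degree_d_two_valued_iff\<close>).  By Vieta this says \<open>e\<^sub>k(x\<^sub>A) = e\<^sub>k(x\<^sub>B)\<close> for \<open>1 \<le> k < d\<close>, independently of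
  \<open>u\<close> and \<open>v\<close>, and it provides one endomorphism for each of the \<open>2d(2d - 1)\<close> ordered pairs of distinct
  points.  For two partitions, \<open>g\<^sub>A g\<^sub>B = g\<^sub>C g\<^sub>D\<close>.  Completing squares, possible as \<open>2 \<noteq> 0\<close>,
  turns this into \<open>s\<^sup>2 - t\<^sup>2 = const\<close> with \<open>s\<close>, \<open>t\<close> monic of degree \<open>d\<close>; as \<open>s + t\<close> has degree
  \<open>d\<close>, this forces \<open>s = t\<close> and then equality of the partitions (\<open>split_conf_disjoint\<close>).

  What remains is the dimension of the variety \<open>V\<close> of these configurations.  Write \<open>c\<close> for the
  constant \<open>g\<^sub>A - g\<^sub>B\<close>.  The point \<open>(x\<^sub>A, c)\<close> determines \<open>g\<^sub>B\<close>, hence \<open>x\<^sub>B\<close> up to order: \<open>V\<close> is finite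
  over an open subset of the affine space with coordinates \<open>(x\<^sub>A, c)\<close>, of dimension \<open>d + 1\<close>, and the
  fibres are the orbits of the group \<open>G\<close> of permutations of \<open>B\<close>.  Both inequalities use only this,
  and avoid commutative algebra.

  \<^item> Upper bound.  If \<open>Z \<subset> Z'\<close> are irreducible and closed and \<open>g\<close> vanishes on \<open>Z\<close> but not on \<open>Z'\<close>, then
    multiplication by \<open>g\<close> is injective on functions on \<open>Z'\<close>, and its image is independent of any lifts of
    independent functions on \<open>Z\<close>.  Along a chain of length \<open>m\<close> the number of independent functions of
    degree at most \<open>s N\<close> therefore grows at least like \<open>N\<^sup>m\<close> (\<open>chain_growth\<close>).  On \<open>V\<close> each \<open>x\<^sub>b\<close> satisfies
    a monic equation of degree \<open>d\<close> over the polynomials in \<open>(x\<^sub>A, c)\<close>, so that this number is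
    \<open>O(N\<^bsup>d+1\<^esup>)\<close> (\<open>poly_fun_deg_in_normal_span\<close>), whence \<open>m \<le> d + 1\<close>.

  \<^item> Lower bound.  For a \<open>G\<close>-stable closed \<open>Y \<subseteq> V\<close> take a closed set \<open>Z\<close> that is minimal among those that meet every
    \<open>G\<close>-orbit of \<open>Y\<close>.  It is irreducible as soon as \<open>Y\<close> is not the union of two proper
    \<open>G\<close>-stable closed subsets.  The sets \<open>Y\<close> obtained from \<open>V\<close> by fixing some of the coordinates \<open>x\<^sub>a\<close> have
    this property, because \<open>G\<close>-invariant polynomials are polynomials in \<open>(x\<^sub>A, c)\<close>
    (\<open>invariants_descend\<close>) and two nonzero polynomials on the base are both
    nonzero at some point (\<open>invariants_both_nonzero\<close>).  Fixing one more coordinate at a time, and finally a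
    point, gives a chain of length \<open>d + 1\<close> (\<open>exists_irreducible_chain\<close>).
\<close>

section \<open>Monic polynomials with given roots\<close>

definition root_poly :: "'i set \<Rightarrow> ('i \<Rightarrow> 'a::field) \<Rightarrow> 'a poly" where
  "root_poly S q = (\<Prod>i\<in>S. [:- q i, 1:])"

lemma poly_root_poly: "poly (root_poly S q) t = (\<Prod>i\<in>S. t - q i)"
  by (simp add: root_poly_def poly_prod)

lemma degree_root_poly [simp]: "Polynomial.degree (root_poly S q) = card S"
  unfolding root_poly_def by (subst degree_prod_sum_eq) auto

lemma lead_coeff_root_poly: "poly.coeff (root_poly S q) (card S) = 1"
proof -
  have "poly.coeff (root_poly S q) (Polynomial.degree (root_poly S q)) = 1"
    unfolding root_poly_def by (subst lead_coeff_prod) simp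
  then show ?thesis by simp
qed

lemma degree_diff_const:
  fixes p :: "'a::comm_ring_1 poly"
  assumes "1 \<le> Polynomial.degree p"
  shows "Polynomial.degree (p - [:c:]) = Polynomial.degree p"
  unfolding diff_conv_add_uminus by (rule degree_add_eq_left) (use assms in simp)

text \<open>
  Two monic polynomials of degree \<open>d\<close> that agree at \<open>d\<close> points agree, since their difference has smaller degree.
\<close>

lemma root_poly_unique:
  assumes "inj_on q S" "finite S" "Polynomial.degree p = card S" "poly.coeff p (card S) = 1"
    and "\<And>i. i \<in> S \<Longrightarrow> poly p (q i) = 0"
  shows "p = root_poly S q"
proof (rule poly_eqI_degree_lead_coeff[where A = "q ` S" and n = "card S"])
  fix z assume "z \<in> q ` S"
  then show "poly p z = poly (root_poly S q) z"
    using assms(2,5) by (auto simp: poly_root_poly intro!: prod_zero)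
qed (use assms in \<open>auto simp: lead_coeff_root_poly card_image\<close>)

text \<open>
  Vieta's formulas: \<open>e\<^sub>k\<close> collects the terms of the expanded product that take the root from exactly \<open>k\<close> factors.
\<close>

lemma coeff_root_poly:
  assumes "finite S" "k \<le> card S"
  shows "poly.coeff (root_poly S q) (card S - k) = (-1)^k * elem_sym k S q"
proof -
  have "root_poly S q = (\<Prod>i\<in>S. [:- q i:] + Polynomial.monom 1 1)"
    unfolding root_poly_def by (intro prod.cong refl) (simp add: monom_Suc)
  also have "\<dots> = (\<Sum>Y\<in>Pow S. (\<Prod>i\<in>Y. [:- q i:]) * (\<Prod>i\<in>S - Y. Polynomial.monom 1 1))"
    by (rule prod_add[OF assms(1)])
  also have "\<dots> = (\<Sum>Y\<in>Pow S. Polynomial.monom (\<Prod>i\<in>Y. - q i) (card S - card Y))"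
  proof (intro sum.cong refl)
    fix Y assume "Y \<in> Pow S"
    then have "card (S - Y) = card S - card Y"
      by (intro card_Diff_subset) (auto intro: finite_subset[OF _ assms(1)])
    moreover have "(\<Prod>i\<in>Y. [:- q i:]) = [:\<Prod>i\<in>Y. - q i:]"
      by (induction Y rule: infinite_finite_induct) simp_all
    ultimately show "(\<Prod>i\<in>Y. [:- q i:]) * (\<Prod>i\<in>S - Y. Polynomial.monom 1 1) =
        Polynomial.monom (\<Prod>i\<in>Y. - q i) (card S - card Y)"
      by (simp add: monom_power smult_monom)
  qed
  also have "poly.coeff \<dots> (card S - k) =
      (\<Sum>Y\<in>Pow S. if card Y = k then (\<Prod>i\<in>Y. - q i) else 0)"
    unfolding coeff_sum coeff_monom
  proof (intro sum.cong refl if_cong)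
    fix Y assume "Y \<in> Pow S"
    then have "card Y \<le> card S" using card_mono[OF assms(1)] by blast
    then show "(card S - card Y = card S - k) = (card Y = k)" using assms(2) by linarith
  qed
  also have "\<dots> = (\<Sum>Y\<in>{Y. Y \<subseteq> S \<and> card Y = k}. \<Prod>i\<in>Y. - q i)"
    by (rule sum.mono_neutral_cong_right) (use assms(1) in auto)
  also have "\<dots> = (\<Sum>Y\<in>{Y. Y \<subseteq> S \<and> card Y = k}. (-1)^k * (\<Prod>i\<in>Y. q i))"
    by (intro sum.cong refl) (auto simp: prod_uminus)
  finally show ?thesis
    by (simp add: elem_sym_def sum_distrib_left)
qed

lemma root_polys_differ_by_const_iff:
  assumes "finite S" "finite T" "card S = d" "card T = d"
  shows "(\<exists>\<gamma>. root_poly S q = root_poly T q + [:\<gamma>:]) \<longleftrightarrow>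
         (\<forall>k. 1 \<le> k \<and> k < d \<longrightarrow> elem_sym k S q = elem_sym k T q)"
proof
  assume "\<exists>\<gamma>. root_poly S q = root_poly T q + [:\<gamma>:]"
  then obtain \<gamma> where \<gamma>: "root_poly S q = root_poly T q + [:\<gamma>:]" ..
  show "\<forall>k. 1 \<le> k \<and> k < d \<longrightarrow> elem_sym k S q = elem_sym k T q"
  proof (intro allI impI)
    fix k assume k: "1 \<le> k \<and> k < d"
    have "poly.coeff (root_poly S q) (d - k) = poly.coeff (root_poly T q) (d - k)"
      using k unfolding \<gamma> by (cases "d - k") auto
    then show "elem_sym k S q = elem_sym k T q"
      using k coeff_root_poly[of S k q] coeff_root_poly[of T k q] assms by auto
  qed
next
  assume *: "\<forall>k. 1 \<le> k \<and> k < d \<longrightarrow> elem_sym k S q = elem_sym k T q"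
  have "root_poly S q = root_poly T q + [:poly.coeff (root_poly S q) 0 - poly.coeff (root_poly T q) 0:]"
  proof (rule poly_eqI)
    fix j
    have "poly.coeff (root_poly S q) j = poly.coeff (root_poly T q) j" if "j \<noteq> 0"
    proof (cases "j < d")
      case True
      then show ?thesis
        using that *[rule_format, of "d - j"] coeff_root_poly[of S "d - j" q]
          coeff_root_poly[of T "d - j" q] assms by auto
    next
      case False
      then show ?thesis
        using assms lead_coeff_root_poly[of S q] lead_coeff_root_poly[of T q]
        by (cases "j = d") (auto simp: coeff_eq_0)
    qed
    then show "poly.coeff (root_poly S q) j = poly.coeff (root_poly T q +
        [:poly.coeff (root_poly S q) 0 - poly.coeff (root_poly T q) 0:]) j"
      by (cases j) auto
  qed
  then show "\<exists>\<gamma>. root_poly S q = root_poly T q + [:\<gamma>:]" ..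
qed

section \<open>Configurations whose two halves have root polynomials differing by a constant\<close>

lemma poly_funs_sum:
  "(\<And>i. i \<in> I \<Longrightarrow> f i \<in> poly_funs n) \<Longrightarrow> (\<lambda>x. \<Sum>i\<in>I. f i x) \<in> poly_funs n"
  by (induction I rule: infinite_finite_induct) (auto intro: poly_funs.const poly_funs.add)

lemma poly_funs_prod:
  "(\<And>i. i \<in> I \<Longrightarrow> f i \<in> poly_funs n) \<Longrightarrow> (\<lambda>x. \<Prod>i\<in>I. f i x) \<in> poly_funs n"
  by (induction I rule: infinite_finite_induct) (auto intro: poly_funs.const poly_funs.mult)

lemma poly_funs_diff:
  assumes "f \<in> poly_funs n" "g \<in> poly_funs n"
  shows "(\<lambda>x. f x - g x) \<in> poly_funs n"
  using poly_funs.add[OF assms(1) poly_funs.mult[OF poly_funs.const[of "-1"] assms(2)]] by simp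

locale split_indices =
  fixes d :: nat and A B :: "nat set"
  assumes d_pos: "d \<ge> 1" and union: "A \<union> B = {1..2*d}" and disjoint: "A \<inter> B = {}"
    and card_A: "card A = d" and card_B: "card B = d"
begin

lemma finite_A [simp]: "finite A" and finite_B [simp]: "finite B"
  using union by (metis finite_Un finite_atLeastAtMost)+

lemma A_nonempty: "A \<noteq> {}" and B_nonempty: "B \<noteq> {}"
  using card_A card_B d_pos by auto

lemma A_neq_B: "A \<noteq> B"
  using A_nonempty disjoint by auto

text \<open>
  The condition says that \<open>g\<^sub>A\<close> is constant on the points indexed by \<open>B\<close>.  Of all equivalent
  descriptions this one is the easiest to use, because it involves no division and makes the symmetry under permutations of \<open>B\<close> visible.
\<close>

definition split_conf :: "(nat \<Rightarrow> 'a::field) set" where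
  "split_conf = {q \<in> Conf (2*d). \<exists>\<gamma>. \<forall>b\<in>B. (\<Prod>a\<in>A. q b - q a) = \<gamma>}"

lemma inj_on_split:
  assumes "q \<in> Conf (2*d)"
  shows "inj_on q A" "inj_on q B" "\<And>a b. a \<in> A \<Longrightarrow> b \<in> B \<Longrightarrow> q a \<noteq> q b"
proof -
  have inj: "inj_on q (A \<union> B)" using assms by (simp add: Conf_def union)
  show "inj_on q A" "inj_on q B" using inj by (auto simp: inj_on_Un)
  show "q a \<noteq> q b" if "a \<in> A" "b \<in> B" for a b
    using inj that disjoint by (auto simp: inj_on_def)
qed

text \<open>
  \<open>g\<^sub>A - \<gamma>\<close> is monic of degree \<open>d\<close> and vanishes at the \<open>d\<close> points indexed by \<open>B\<close>; here \<open>d \<ge> 1\<close> keeps the leading coefficient intact.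
\<close>

lemma root_poly_B_eq:
  assumes "q \<in> Conf (2*d)" "\<forall>b\<in>B. (\<Prod>a\<in>A. q b - q a) = \<gamma>"
  shows "root_poly B q = root_poly A q - [:\<gamma>:]"
proof (rule root_poly_unique[symmetric])
  show "Polynomial.degree (root_poly A q - [:\<gamma>:]) = card B"
    using d_pos card_A card_B by (simp add: degree_diff_const)
  show "poly.coeff (root_poly A q - [:\<gamma>:]) (card B) = 1"
    using lead_coeff_root_poly[of A q] d_pos card_A card_B by (cases d) auto
qed (use assms inj_on_split in \<open>auto simp: poly_root_poly\<close>)

lemma split_conf_iff_root_polys:
  "q \<in> split_conf \<longleftrightarrow> q \<in> Conf (2*d) \<and> (\<exists>\<gamma>. root_poly A q = root_poly B q + [:\<gamma>:])"
proof
  assume "q \<in> split_conf"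
  then obtain \<gamma> where q: "q \<in> Conf (2*d)" "\<forall>b\<in>B. (\<Prod>a\<in>A. q b - q a) = \<gamma>"
    unfolding split_conf_def by blast
  have "root_poly A q = root_poly B q + [:\<gamma>:]"
    using root_poly_B_eq[OF q] by simp
  then show "q \<in> Conf (2*d) \<and> (\<exists>\<gamma>. root_poly A q = root_poly B q + [:\<gamma>:])"
    using q(1) by blast
next
  assume "q \<in> Conf (2*d) \<and> (\<exists>\<gamma>. root_poly A q = root_poly B q + [:\<gamma>:])"
  then obtain \<gamma> where q: "q \<in> Conf (2*d)" and \<gamma>: "root_poly A q = root_poly B q + [:\<gamma>:]"
    by blast
  have "(\<Prod>a\<in>A. q b - q a) = \<gamma>" if "b \<in> B" for b
  proof -
    have "poly (root_poly B q) (q b) = 0"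
      using that by (auto simp: poly_root_poly)
    then show ?thesis
      using arg_cong[OF \<gamma>, of "\<lambda>p. poly p (q b)"] by (simp add: poly_root_poly)
  qed
  then show "q \<in> split_conf"
    using q unfolding split_conf_def by blast
qed

lemma split_conf_eq_elem_sym:
  "split_conf = {q \<in> Conf (2*d). \<forall>k. 1 \<le> k \<and> k < d \<longrightarrow> elem_sym k A q = elem_sym k B q}"
  by (rule Set.set_eqI)
    (simp add: split_conf_iff_root_polys root_polys_differ_by_const_iff[OF finite_A finite_B card_A card_B])

text \<open>
  The constant is nonzero since no point of \<open>B\<close> is a root of \<open>g\<^sub>A\<close>.
\<close>

lemma split_conf_level:
  assumes "q \<in> split_conf"
  obtains \<gamma> where "\<gamma> \<noteq> 0" "root_poly A q = root_poly B q + [:\<gamma>:]"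
    "\<And>b. b \<in> B \<Longrightarrow> (\<Prod>a\<in>A. q b - q a) = \<gamma>"
proof -
  obtain \<gamma> where q: "q \<in> Conf (2*d)" and *: "\<And>b. b \<in> B \<Longrightarrow> (\<Prod>a\<in>A. q b - q a) = \<gamma>"
    using assms unfolding split_conf_def by blast
  have \<gamma>: "root_poly A q = root_poly B q + [:\<gamma>:]"
    using root_poly_B_eq[OF q, of \<gamma>] * by simp
  obtain b where b: "b \<in> B" using B_nonempty by blast
  have "(\<Prod>a\<in>A. q b - q a) \<noteq> 0"
    unfolding prod_zero_iff[OF finite_A] right_minus_eq using inj_on_split(3)[OF q _ b] by metis
  then have "\<gamma> \<noteq> 0" using *[OF b] by simp
  then show thesis using \<gamma> * by (rule that)
qed

text \<open>
  Subtracting one of the two values from \<open>f\<close> and dividing by the leading coefficient yields \<open>g\<^sub>A\<close> or \<open>g\<^sub>B\<close>.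
  In the other direction \<open>f = (v - u)/\<gamma> \<cdot> g\<^sub>A + u\<close> works.  The membership in \<open>split_conf\<close> no longer mentions \<open>u\<close> and \<open>v\<close>,
  which is why the choice of a portrait with the given fibres is immaterial.
\<close>

lemma degree_d_two_valued_iff:
  assumes q: "q \<in> Conf (2*d)" and uv: "u \<noteq> v"
  shows "(\<exists>f. Polynomial.degree f = d \<and> (\<forall>a\<in>A. poly f (q a) = u) \<and> (\<forall>b\<in>B. poly f (q b) = v))
     \<longleftrightarrow> q \<in> split_conf"
proof
  assume "\<exists>f. Polynomial.degree f = d \<and> (\<forall>a\<in>A. poly f (q a) = u) \<and> (\<forall>b\<in>B. poly f (q b) = v)"
  then obtain f where f: "Polynomial.degree f = d" "\<And>a. a \<in> A \<Longrightarrow> poly f (q a) = u"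
    "\<And>b. b \<in> B \<Longrightarrow> poly f (q b) = v" by blast
  define s where "s = poly.coeff f d"
  have s: "s \<noteq> 0" using f(1) d_pos unfolding s_def by (metis degree_0 leading_coeff_0_iff not_one_le_zero)
  have *: "smult (1/s) (f - [:w:]) = root_poly S q"
    if S: "finite S" "card S = d" "inj_on q S" "\<And>i. i \<in> S \<Longrightarrow> poly f (q i) = w" for S w
  proof (rule root_poly_unique)
    have "Polynomial.degree (f - [:w:]) = d"
      using f(1) d_pos by (simp add: degree_diff_const)
    then show "Polynomial.degree (smult (1/s) (f - [:w:])) = card S"
      using s S by simp
    show "poly.coeff (smult (1/s) (f - [:w:])) (card S) = 1"
      using s S d_pos by (cases d) (auto simp: s_def)
  qed (use S in auto)
  have "smult (1/s) (f - [:u:]) = root_poly A q" "smult (1/s) (f - [:v:]) = root_poly B q"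
    using f inj_on_split[OF q] card_A card_B by (auto intro!: *)
  moreover have "smult (1/s) (f - [:u:]) = smult (1/s) (f - [:v:]) + [:(v - u) / s:]"
    by (rule poly_eqI) (simp add: coeff_pCons algebra_simps diff_divide_distrib split: nat.split)
  ultimately have "root_poly A q = root_poly B q + [:(v - u) / s:]" by simp
  then show "q \<in> split_conf"
    using q split_conf_iff_root_polys by blast
next
  assume "q \<in> split_conf"
  then obtain \<gamma> where \<gamma>: "\<gamma> \<noteq> 0" "\<And>b. b \<in> B \<Longrightarrow> (\<Prod>a\<in>A. q b - q a) = \<gamma>"
    by (rule split_conf_level) blast
  define f where "f = smult ((v - u) / \<gamma>) (root_poly A q) + [:u:]"
  have "Polynomial.degree f = d"
    unfolding f_def using uv \<gamma>(1) d_pos card_A by (subst degree_add_eq_left) auto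
  moreover have "poly f (q a) = u" if "a \<in> A" for a
    unfolding f_def using that by (auto simp: poly_root_poly)
  moreover have "poly f (q b) = v" if "b \<in> B" for b
    unfolding f_def using \<gamma>(1) by (simp add: poly_root_poly \<gamma>(2)[OF that])
  ultimately show "\<exists>f. Polynomial.degree f = d \<and> (\<forall>a\<in>A. poly f (q a) = u) \<and> (\<forall>b\<in>B. poly f (q b) = v)"
    by blast
qed

lemma two_image_portrait_values:
  assumes "two_image_portrait d P" "fiber_partition (2*d) P = {A, B}"
  obtains i j where "i \<in> {1..2*d}" "j \<in> {1..2*d}" "i \<noteq> j"
    "\<And>a. a \<in> A \<Longrightarrow> P a = i" "\<And>b. b \<in> B \<Longrightarrow> P b = j"
proof -
  have "A \<in> fiber_partition (2*d) P" "B \<in> fiber_partition (2*d) P"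
    using assms(2) by auto
  then obtain i j where ij: "A = {l \<in> {1..2*d}. P l = i}" "i \<in> P ` {1..2*d}"
    "B = {l \<in> {1..2*d}. P l = j}" "j \<in> P ` {1..2*d}"
    unfolding fiber_partition_def by blast
  have "P ` {1..2*d} \<subseteq> {1..2*d}"
    using assms(1) by (auto simp: two_image_portrait_def is_portrait_def Pi_def)
  then show thesis
    using that[of i j] ij A_neq_B by blast
qed

lemma Conf_portrait_eq_split_conf:
  assumes "two_image_portrait d P" "fiber_partition (2*d) P = {A, B}"
  shows "Conf_portrait (2*d) P d = split_conf"
proof -
  obtain i j where ij: "i \<in> {1..2*d}" "j \<in> {1..2*d}" "i \<noteq> j"
    "\<And>a. a \<in> A \<Longrightarrow> P a = i" "\<And>b. b \<in> B \<Longrightarrow> P b = j"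
    using two_image_portrait_values[OF assms] by blast
  have "q \<in> Conf_portrait (2*d) P d \<longleftrightarrow> q \<in> split_conf" for q :: "nat \<Rightarrow> 'a"
  proof (cases "q \<in> Conf (2*d)")
    case True
    then have "inj_on q {1..2*d}" by (simp add: Conf_def)
    then have "q i \<noteq> q j" using ij(1-3) by (blast dest: inj_onD)
    have "(\<forall>l\<in>{1..2*d}. poly f (q l) = q (P l)) \<longleftrightarrow>
        (\<forall>a\<in>A. poly f (q a) = q i) \<and> (\<forall>b\<in>B. poly f (q b) = q j)" for f
      unfolding union[symmetric] ball_Un using ij(4,5) by simp
    then show ?thesis
      using degree_d_two_valued_iff[OF True \<open>q i \<noteq> q j\<close>] True by (simp add: Conf_portrait_def)
  next
    case False
    then show ?thesis by (auto simp: Conf_portrait_def split_conf_def)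
  qed
  then show ?thesis by blast
qed

lemma exists_two_image_portrait:
  "\<exists>P. two_image_portrait d P \<and> fiber_partition (2*d) P = {A, B}"
proof -
  define P where "P = (\<lambda>l. if l \<in> A then 1 else 2 :: nat)"
  have A: "A = {l \<in> {1..2*d}. P l = 1}" and B: "B = {l \<in> {1..2*d}. P l = 2}"
    using union disjoint by (auto simp: P_def)
  have im: "P ` {1..2*d} = {1, 2}"
  proof
    obtain a b where "a \<in> A" "b \<in> B" using A_nonempty B_nonempty by blast
    then have "P a = 1" "P b = 2" "a \<in> {1..2*d}" "b \<in> {1..2*d}" using A B by blast+
    then show "{1, 2} \<subseteq> P ` {1..2*d}" by (metis empty_subsetI imageI insert_subset)
  qed (auto simp: P_def)
  have fp: "fiber_partition (2*d) P = {A, B}"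
    unfolding fiber_partition_def im A B by auto
  have "half_partition d {A, B}"
    using A_neq_B card_A card_B union disjoint A_nonempty B_nonempty
    by (auto simp: half_partition_def partition_on_def disjoint_def)
  moreover have "is_portrait (2*d) P"
    using d_pos by (auto simp: is_portrait_def P_def)
  ultimately show ?thesis
    using fp by (auto simp: two_image_portrait_def)
qed

lemma Conf_partition_eq_split_conf: "Conf_partition {A, B} d = split_conf"
  unfolding Conf_partition_def
  using someI_ex[OF exists_two_image_portrait] by (intro Conf_portrait_eq_split_conf) auto

lemma closedin_split_conf:
  "closedin (subtopology (zariski (2*d)) (Conf (2*d))) split_conf"
proof -
  define F :: "((nat \<Rightarrow> 'a) \<Rightarrow> 'a) set"
    where "F = {\<lambda>x. elem_sym k A x - elem_sym k B x | k. 1 \<le> k \<and> k < d}"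
  have "elem_sym k S \<in> poly_funs (2*d)" if "S \<subseteq> {1..2*d}" for k and S :: "nat set"
    unfolding elem_sym_def[abs_def]
    using that finite_subset[OF that] by (intro poly_funs_sum poly_funs_prod poly_funs.coord) auto
  then have "F \<subseteq> poly_funs (2*d)"
    unfolding F_def using union by (auto intro!: poly_funs_diff)
  then have "closedin (zariski (2*d)) (zero_locus (2*d) F)"
    unfolding closedin_zariski by blast
  moreover have "split_conf = Conf (2*d) \<inter> zero_locus (2*d) F"
  proof (rule Set.set_eqI)
    fix q :: "nat \<Rightarrow> 'a"
    have "q \<in> zero_locus (2*d) F \<longleftrightarrow> (\<forall>k. 1 \<le> k \<and> k < d \<longrightarrow> elem_sym k A q = elem_sym k B q)"
      if "q \<in> Conf (2*d)"
      using that unfolding zero_locus_def F_def Conf_def by fastforce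
    then show "q \<in> split_conf \<longleftrightarrow> q \<in> Conf (2*d) \<inter> zero_locus (2*d) F"
      unfolding split_conf_eq_elem_sym by blast
  qed
  ultimately show ?thesis
    unfolding closedin_subtopology by blast
qed

text \<open>
  Each ordered pair of distinct points of the configuration is the pair of values of a polynomial of degree \<open>d\<close>
  that is constant on both halves, and the polynomial determines the pair.
\<close>

lemma card_End_deg_ge:
  assumes q: "q \<in> split_conf"
  shows "2*d * (2*d - 1) \<le> card (End_deg (2*d) d q)"
proof -
  have qC: "q \<in> Conf (2*d)" using q by (simp add: split_conf_def)
  have q_inj: "inj_on q {1..2*d}" using qC by (simp add: Conf_def)
  define I where "I = (SIGMA i:{1..2*d}. {1..2*d} - {i})"
  have "\<exists>f. Polynomial.degree f = d \<and> (\<forall>a\<in>A. poly f (q a) = q (fst ij)) \<and>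
      (\<forall>b\<in>B. poly f (q b) = q (snd ij))" if "ij \<in> I" for ij
  proof -
    have "q (fst ij) \<noteq> q (snd ij)"
      using that inj_on_contraD[OF q_inj, of "fst ij" "snd ij"] by (auto simp: I_def)
    then show ?thesis using degree_d_two_valued_iff[OF qC] q by blast
  qed
  then obtain F where F: "\<And>ij. ij \<in> I \<Longrightarrow> Polynomial.degree (F ij) = d \<and>
      (\<forall>a\<in>A. poly (F ij) (q a) = q (fst ij)) \<and> (\<forall>b\<in>B. poly (F ij) (q b) = q (snd ij))"
    by metis
  have inj: "inj_on F I"
  proof (rule inj_onI)
    fix x y assume xy: "x \<in> I" "y \<in> I" "F x = F y"
    obtain a b where ab: "a \<in> A" "b \<in> B" using A_nonempty B_nonempty by blast
    have "q (fst x) = q (fst y)" "q (snd x) = q (snd y)"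
      using F[OF xy(1)] F[OF xy(2)] xy(3) ab by metis+
    then show "x = y"
      using xy(1,2) inj_onD[OF q_inj] unfolding I_def
      by (metis DiffE mem_Sigma_iff prod.collapse)
  qed
  have sub: "F ` I \<subseteq> End_deg (2*d) d q"
  proof
    fix f assume "f \<in> F ` I"
    then obtain ij where ij: "ij \<in> I" "f = F ij" by blast
    have "poly f (q l) \<in> q ` {1..2*d}" if "l \<in> A \<union> B" for l
      using that F[OF ij(1)] ij by (auto simp: I_def)
    then show "f \<in> End_deg (2*d) d q"
      using F[OF ij(1)] ij(2) unfolding union by (auto simp: End_deg_def End_conf_def)
  qed
  have "2*d * (2*d - 1) = card I"
    unfolding I_def by (simp add: card_SigmaI)
  also have "card I = card (F ` I)" using inj by (simp add: card_image)
  also have "\<dots> \<le> card (End_deg (2*d) d q)"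
    by (rule card_mono[OF End_deg_bound(1)[OF qC] sub]) (use d_pos in simp)
  finally show ?thesis .
qed

end

section \<open>Disjointness for distinct partitions\<close>

lemma split_indices_of_half_partition:
  assumes "d \<ge> 1" "half_partition d {A, B}"
  shows "split_indices d A B"
proof
  have p: "partition_on {1..2*d} {A, B}" "card {A, B} = 2" "card A = d" "card B = d"
    using assms(2) by (auto simp: half_partition_def)
  have "A \<noteq> B" using p(2) by auto
  then show "A \<inter> B = {}" using p(1) by (auto simp: partition_on_def disjoint_def)
  show "A \<union> B = {1..2*d}" using p(1) by (auto simp: partition_on_def)
qed (use assms in \<open>auto simp: half_partition_def\<close>)

text \<open>
  Otherwise \<open>(s - t)(s + t)\<close> would have degree at least that of \<open>s + t\<close>, whose leading coefficient is \<open>2\<close>.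
\<close>

lemma monic_squares_differ_by_const:
  fixes s t :: "'a::field poly"
  assumes "(2::'a) \<noteq> 0" "Polynomial.degree s = d" "Polynomial.degree t = d" "d \<ge> 1"
    "poly.coeff s d = 1" "poly.coeff t d = 1" "s * s - t * t = [:c:]"
  shows "s = t"
proof (rule ccontr)
  assume "s \<noteq> t"
  have "poly.coeff (s + t) d = 2" using assms by simp
  then have "poly.coeff (s + t) d \<noteq> 0" using assms(1) by simp
  then have "d \<le> Polynomial.degree (s + t)" and nz: "s + t \<noteq> 0"
    by (rule le_degree) (use \<open>poly.coeff (s + t) d \<noteq> 0\<close> in force)
  moreover have "Polynomial.degree ((s - t) * (s + t)) =
      Polynomial.degree (s - t) + Polynomial.degree (s + t)"
    using \<open>s \<noteq> t\<close> nz by (intro degree_mult_eq) auto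
  moreover have "(s - t) * (s + t) = [:c:]" using assms(7) by (simp add: algebra_simps)
  ultimately show False using assms(4) by simp
qed

text \<open>
  Put \<open>s = g\<^sub>A - \<gamma>/2\<close> and \<open>t = g\<^sub>C - \<delta>/2\<close>.  Both \<open>g\<^sub>A g\<^sub>B = s\<^sup>2 - \<gamma>\<^sup>2/4\<close> and \<open>g\<^sub>C g\<^sub>D = t\<^sup>2 - \<delta>\<^sup>2/4\<close>
  are the product over all points, so \<open>s = t\<close> and \<open>\<gamma> = \<plusminus>\<delta>\<close>.
\<close>

lemma split_conf_disjoint:
  fixes q :: "nat \<Rightarrow> 'a::field"
  assumes char: "(2::'a) \<noteq> 0"
    and AB: "split_indices d A B" and CD: "split_indices d C D"
    and qAB: "q \<in> split_indices.split_conf d A B" and qCD: "q \<in> split_indices.split_conf d C D"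
  shows "{A, B} = {C, D}"
proof -
  interpret AB: split_indices d A B by fact
  interpret CD: split_indices d C D by fact
  obtain \<gamma> where \<gamma>: "root_poly A q = root_poly B q + [:\<gamma>:]"
    using AB.split_conf_level[OF qAB] by metis
  obtain \<delta> where \<delta>: "root_poly C q = root_poly D q + [:\<delta>:]"
    using CD.split_conf_level[OF qCD] by metis
  have inj: "inj_on q {1..2*d}" using qAB by (simp add: AB.split_conf_def Conf_def)
  have eq: "root_poly A q * root_poly B q = root_poly C q * root_poly D q"
    unfolding root_poly_def
    by (subst (1 2) prod.union_disjoint[symmetric]) (auto simp: AB.disjoint CD.disjoint AB.union CD.union)
  define s where "s = root_poly A q - [:\<gamma>/2:]"
  define t where "t = root_poly C q - [:\<delta>/2:]"
  have half: "[:x/2:] + [:x/2:] = [:x:]" for x :: 'a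
  proof -
    have "x/2 + x/2 = (2 * x) / 2" by (simp only: mult_2 add_divide_distrib)
    also have "\<dots> = x" using char by (rule nonzero_mult_div_cancel_left)
    finally show ?thesis by simp
  qed
  have B: "root_poly B q = s - [:\<gamma>/2:]" and D: "root_poly D q = t - [:\<delta>/2:]"
    unfolding s_def t_def diff_diff_eq half by (simp_all add: \<gamma> \<delta>)
  have A: "root_poly A q = s + [:\<gamma>/2:]" and C: "root_poly C q = t + [:\<delta>/2:]"
    by (auto simp: s_def t_def)
  have deg: "Polynomial.degree s = d" "Polynomial.degree t = d"
    unfolding s_def t_def using AB.card_A CD.card_A AB.d_pos by (simp_all add: degree_diff_const)
  have "s * s - t * t = [:\<gamma>/2:] * [:\<gamma>/2:] - [:\<delta>/2:] * [:\<delta>/2:]"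
  proof -
    have "(s + g) * (s - g) = (t + h) * (t - h) \<Longrightarrow> s * s - t * t = g * g - h * h" for g h
      by (simp add: algebra_simps)
    from this[OF eq[unfolded A B C D]] show ?thesis .
  qed
  also have "\<dots> = [:(\<gamma>/2) * (\<gamma>/2) - (\<delta>/2) * (\<delta>/2):]" by simp
  finally have "s * s - t * t = [:(\<gamma>/2) * (\<gamma>/2) - (\<delta>/2) * (\<delta>/2):]" .
  then have st: "s = t"
    using monic_squares_differ_by_const[OF char deg AB.d_pos] lead_coeff_root_poly[of A q]
      lead_coeff_root_poly[of C q] AB.d_pos AB.card_A CD.card_A
    by (cases d) (auto simp: s_def t_def)
  have "[:\<gamma>/2:] * [:\<gamma>/2:] = [:\<delta>/2:] * [:\<delta>/2:]"
  proof -
    have "(t + g) * (t - g) = (t + h) * (t - h) \<Longrightarrow> g * g = h * h" for g h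
      by (simp add: algebra_simps)
    from this[OF eq[unfolded A B C D st]] show ?thesis .
  qed
  then have "[:\<gamma>/2:] = [:\<delta>/2:] \<or> [:\<gamma>/2:] = - [:\<delta>/2:]"
    by (simp only: square_eq_iff)
  then have "root_poly A q = root_poly C q \<or> root_poly A q = root_poly D q"
    unfolding A C D st by auto
  moreover have "S = T" if "root_poly S q = root_poly T q" "S \<subseteq> {1..2*d}" "T \<subseteq> {1..2*d}" for S T
  proof -
    have zeros: "q ` S = {x. poly (root_poly S q) x = 0}" if "S \<subseteq> {1..2*d}" for S
      using finite_subset[OF that] by (auto simp: poly_root_poly)
    have "q ` S = q ` T" using zeros[OF that(2)] zeros[OF that(3)] that(1) by simp
    then show ?thesis using inj_on_image_eq_iff[OF inj that(2,3)] by simp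
  qed
  ultimately have "A = C \<or> A = D"
    using AB.union CD.union by blast
  then show ?thesis
    using AB.union CD.union AB.disjoint CD.disjoint by blast
qed

section \<open>Algebras of functions\<close>

text \<open>
  The algebra of functions on \<open>V\<close> generated by \<open>S\<close>.  Its members are functions on the whole type; the rule \<open>cong\<close>
  lets only their values on \<open>V\<close> matter, so that relations that hold on \<open>V\<close> can be used freely.  Products are
  restricted to a generator on the left, which makes inductions over normal forms easy.
\<close>

inductive_set subalg :: "'x set \<Rightarrow> ('x \<Rightarrow> 'a::comm_ring_1) set \<Rightarrow> ('x \<Rightarrow> 'a) set" for V S where
  const: "(\<lambda>x. c) \<in> subalg V S"
| gen_mult: "s \<in> S \<Longrightarrow> f \<in> subalg V S \<Longrightarrow> (\<lambda>x. s x * f x) \<in> subalg V S"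
| add: "f \<in> subalg V S \<Longrightarrow> g \<in> subalg V S \<Longrightarrow> (\<lambda>x. f x + g x) \<in> subalg V S"
| cong: "f \<in> subalg V S \<Longrightarrow> (\<forall>x\<in>V. f x = g x) \<Longrightarrow> g \<in> subalg V S"

lemma subalg_gen: "s \<in> S \<Longrightarrow> s \<in> subalg V S"
  using subalg.gen_mult[OF _ subalg.const[of 1]] by fastforce

lemma subalg_mult:
  assumes "f \<in> subalg V S" "g \<in> subalg V S"
  shows "(\<lambda>x. f x * g x) \<in> subalg V S"
  using assms(1)
proof induction
  case (const c)
  show ?case using assms(2)
  proof induction
    case (gen_mult s f)
    then show ?case using subalg.gen_mult[OF gen_mult(1,3)] by (simp add: mult.left_commute)
  next
    case (add f g)
    then show ?case using subalg.add[OF add(3,4)] by (simp add: distrib_left)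
  next
    case (cong f g)
    then show ?case by (auto intro: subalg.cong[OF cong(3)])
  qed (rule subalg.const)
next
  case (gen_mult s f)
  then show ?case using subalg.gen_mult[OF gen_mult(1,3)] by (simp add: mult.assoc)
next
  case (add f g)
  then show ?case using subalg.add[OF add(3,4)] by (simp add: distrib_right)
next
  case (cong f g)
  then show ?case by (auto intro: subalg.cong[OF cong(3)])
qed

lemma subalg_diff:
  assumes "f \<in> subalg V S" "g \<in> subalg V S"
  shows "(\<lambda>x. f x - g x) \<in> subalg V S"
  using subalg.add[OF assms(1) subalg_mult[OF subalg.const[of "-1"] assms(2)]] by simp

lemma subalg_mono:
  assumes "f \<in> subalg V S" "S \<subseteq> T"
  shows "f \<in> subalg V T"
  using assms(1)
proof induction
  case (gen_mult s f)
  then show ?case using assms(2) by (intro subalg.gen_mult) auto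
next
  case (cong f g)
  then show ?case by (blast intro: subalg.cong)
qed (auto intro: subalg.const subalg.add)

lemma subalg_polynomial_along_curve:
  assumes "f \<in> subalg UNIV S" "\<And>s. s \<in> S \<Longrightarrow> \<exists>p. \<forall>t. s (\<phi> t) = poly p t"
  shows "\<exists>p. \<forall>t. f (\<phi> t) = poly p t"
  using assms(1)
proof induction
  case (const c)
  show ?case by (intro exI[of _ "[:c:]"]) simp
next
  case (gen_mult s f)
  then show ?case using assms(2) by (metis poly_mult)
next
  case (add f g)
  then show ?case by (metis poly_add)
next
  case (cong f g)
  then show ?case by simp
qed

text \<open>
  In a finite field \<open>\<Prod>\<^sub>i (T - i) + 1\<close> has no root.
\<close>

lemma infinite_UNIV_alg_closed: "infinite (UNIV :: 'a::alg_closed_field set)"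
proof
  assume fin: "finite (UNIV :: 'a set)"
  define p :: "'a poly" where "p = root_poly UNIV (\<lambda>x. x) + 1"
  have "card (UNIV :: 'a set) > 0" using fin by (simp add: card_gt_0_iff)
  then have "Polynomial.degree p > 0"
    unfolding p_def by (subst degree_add_eq_left) auto
  then obtain r where "poly p r = 0" using alg_closed_imp_poly_has_root by blast
  moreover have "(\<Prod>i\<in>UNIV. r - i) = 0"
    using fin by (auto intro: prod_zero)
  ultimately show False by (simp add: p_def poly_root_poly)
qed

text \<open>
  Splitting off a root \<open>r\<close> leaves a factor that does not vanish at \<open>r\<close> and has no multiple roots either.
\<close>

lemma card_roots_separable:
  fixes p :: "'a::alg_closed_field poly"
  assumes "p \<noteq> 0" "\<And>r. poly p r = 0 \<Longrightarrow> poly (pderiv p) r \<noteq> 0"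
  shows "card {r. poly p r = 0} = Polynomial.degree p"
  using assms
proof (induction "Polynomial.degree p" arbitrary: p)
  case 0
  then obtain c where "p = [:c:]" "c \<noteq> 0"
    by (metis degree_eq_zeroE pCons_eq_0_iff)
  then show ?case by simp
next
  case (Suc n)
  then obtain r where "poly p r = 0" using alg_closed_imp_poly_has_root[of p] by auto
  then obtain h where p: "p = [:-r, 1:] * h"
    unfolding poly_eq_0_iff_dvd dvd_def by blast
  have h: "h \<noteq> 0" using Suc.prems(1) p by auto
  have deriv: "poly (pderiv p) s = poly h s + (s - r) * poly (pderiv h) s" for s
  proof -
    have "pderiv [:-r, 1:] = 1" by (simp add: pderiv_pCons)
    then show ?thesis unfolding p pderiv_mult by (simp del: mult_pCons_left add: algebra_simps)
  qed
  have zero: "poly p s = (s - r) * poly h s" for s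
    unfolding p by (simp add: algebra_simps)
  have deg: "Polynomial.degree p = Suc (Polynomial.degree h)"
    unfolding p using h by (subst degree_mult_eq) auto
  have "card {r. poly h r = 0} = Polynomial.degree h"
  proof (rule Suc.hyps(1))
    show "n = Polynomial.degree h" using deg Suc.hyps(2) by simp
    fix s assume "poly h s = 0"
    then show "poly (pderiv h) s \<noteq> 0"
      using Suc.prems(2)[of s] by (auto simp: zero deriv)
  qed fact
  moreover have "poly h r \<noteq> 0" using Suc.prems(2)[of r] by (auto simp: zero deriv)
  moreover have "{s. poly p s = 0} = insert r {s. poly h s = 0}"
    by (auto simp: zero)
  ultimately show ?case
    using poly_roots_finite[OF h] by (simp add: deg)
qed

lemma coeff_root_poly_subalg:
  assumes "finite S" "\<And>i. i \<in> S \<Longrightarrow> (\<lambda>q. q i) \<in> subalg V T"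
  shows "(\<lambda>q. poly.coeff (root_poly S q) l) \<in> subalg V T"
  using assms
proof (induction S arbitrary: l rule: finite_induct)
  case empty
  then show ?case by (simp add: root_poly_def subalg.const)
next
  case (insert i S)
  have eq: "poly.coeff (root_poly (insert i S) q) l =
      (if l = 0 then 0 else poly.coeff (root_poly S q) (l - 1)) - q i * poly.coeff (root_poly S q) l" for q
  proof -
    have "root_poly (insert i S) q = [:- q i, 1:] * root_poly S q"
      using insert.hyps unfolding root_poly_def by simp
    then show ?thesis by (cases l) simp_all
  qed
  moreover have "(\<lambda>q. (if l = 0 then 0 else poly.coeff (root_poly S q) (l - 1)) - q i * poly.coeff (root_poly S q) l)
      \<in> subalg V T"
    using insert by (intro subalg_diff subalg_mult) (cases l, auto intro: subalg.const)
  ultimately show ?case unfolding eq by blast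
qed

context split_indices
begin

section \<open>Invariant polynomials descend to the base\<close>

text \<open>
  The constant \<open>g\<^sub>A - g\<^sub>B\<close>.  Evaluating \<open>g\<^sub>A\<close> at one chosen point of \<open>B\<close> gives a polynomial in the coordinates; on
  \<open>split_conf\<close> the choice does not matter.
\<close>

definition level :: "(nat \<Rightarrow> 'a::field) \<Rightarrow> 'a" where
  "level q = (\<Prod>a\<in>A. q (SOME b. b \<in> B) - q a)"

lemma some_B: "(SOME b. b \<in> B) \<in> B"
  using B_nonempty by (simp add: some_in_eq)

lemma level_eq:
  assumes "q \<in> split_conf" "b \<in> B"
  shows "(\<Prod>a\<in>A. q b - q a) = level q"
proof -
  obtain \<gamma> where \<gamma>: "\<forall>b\<in>B. (\<Prod>a\<in>A. q b - q a) = \<gamma>"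
    using assms(1) unfolding split_conf_def by blast
  show ?thesis unfolding level_def bspec[OF \<gamma> some_B] bspec[OF \<gamma> assms(2)] ..
qed

lemma root_poly_B_level:
  assumes "q \<in> split_conf"
  shows "root_poly B q = root_poly A q - [:level q:]"
  by (rule root_poly_B_eq) (use assms in \<open>simp add: split_conf_def\<close>, intro ballI level_eq assms)

lemma split_confD:
  assumes "q \<in> split_conf"
  shows "inj_on q A" "inj_on q B" "q \<in> affine_space (2*d)"
proof -
  have q: "q \<in> Conf (2*d)" using assms unfolding split_conf_def by blast
  show "inj_on q A" "inj_on q B" using inj_on_split(1,2)[OF q] .
  show "q \<in> affine_space (2*d)" using q unfolding Conf_def by blast
qed

lemma perm_A: "\<sigma> permutes B \<Longrightarrow> a \<in> A \<Longrightarrow> \<sigma> a = a"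
  by (erule permutes_not_in) (use disjoint in blast)

text \<open>
  Permutations of \<open>B\<close> fix \<open>g\<^sub>A\<close> and only reorder the points at which it is evaluated.
\<close>

lemma split_conf_perm:
  assumes q: "q \<in> split_conf" and \<sigma>: "\<sigma> permutes B"
  shows "q \<circ> \<sigma> \<in> split_conf"
proof -
  have "B \<subseteq> {1..2*d}" using union by blast
  then have \<sigma>': "\<sigma> permutes {1..2*d}" using \<sigma> by (rule permutes_subset[rotated])
  have qC: "q \<in> affine_space (2*d)" "inj_on q {1..2*d}"
    using q unfolding split_conf_def Conf_def by blast+
  have "q \<circ> \<sigma> \<in> affine_space (2*d)"
  proof (rule PiE_I)
    fix i assume i: "i \<notin> {1..2*d}"
    show "(q \<circ> \<sigma>) i = undefined"
      using permutes_not_in[OF \<sigma>' i] PiE_arb[OF qC(1) i] by simp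
  qed simp
  moreover have "inj_on (q \<circ> \<sigma>) {1..2*d}"
    by (rule comp_inj_on[OF permutes_inj_on[OF \<sigma>']]) (simp only: permutes_image[OF \<sigma>'] qC(2))
  ultimately have "q \<circ> \<sigma> \<in> Conf (2*d)" unfolding Conf_def by blast
  moreover have "(\<Prod>a\<in>A. (q \<circ> \<sigma>) b - (q \<circ> \<sigma>) a) = level q" if "b \<in> B" for b
  proof -
    have "(\<Prod>a\<in>A. (q \<circ> \<sigma>) b - (q \<circ> \<sigma>) a) = (\<Prod>a\<in>A. q (\<sigma> b) - q a)"
      using perm_A[OF \<sigma>] by (intro prod.cong) simp_all
    also have "\<dots> = level q"
      by (rule level_eq[OF q]) (simp only: permutes_in_image[OF \<sigma>] that)
    finally show ?thesis .
  qed
  ultimately show ?thesis unfolding split_conf_def by blast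
qed

lemma level_perm:
  assumes "q \<in> split_conf" "\<sigma> permutes B"
  shows "level (q \<circ> \<sigma>) = level q"
proof -
  have "level (q \<circ> \<sigma>) = (\<Prod>a\<in>A. q (\<sigma> (SOME b. b \<in> B)) - q a)"
    unfolding level_def using perm_A[OF assms(2)] by (intro prod.cong) simp_all
  also have "\<dots> = level q"
    by (rule level_eq[OF assms(1)]) (simp only: permutes_in_image[OF assms(2)] some_B)
  finally show ?thesis .
qed

definition gens :: "nat set \<Rightarrow> ((nat \<Rightarrow> 'a::field) \<Rightarrow> 'a) set" where
  "gens C = insert level ((\<lambda>i q. q i) ` (A \<union> C))"

text \<open>
  For \<open>C = {}\<close> the polynomial is \<open>g\<^sub>A - c\<close>.  Removing a root \<open>q\<^sub>b\<close> is a division by \<open>T - q\<^sub>b\<close>, and the coefficients of the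
  quotient are computed from the top down by Horner's scheme, which uses only \<open>q\<^sub>b\<close> and the old coefficients.
\<close>

lemma coeff_root_poly_rest:
  assumes "finite C" "C \<subseteq> B"
  shows "(\<lambda>q::nat \<Rightarrow> 'a::field. poly.coeff (root_poly (B - C) q) l) \<in> subalg split_conf (gens C)"
  using assms
proof (induction C arbitrary: l rule: finite_induct)
  case empty
  have *: "(\<lambda>q::nat \<Rightarrow> 'a. poly.coeff (root_poly A q) l) \<in> subalg split_conf (gens {})"
    by (rule coeff_root_poly_subalg) (auto intro: subalg_gen simp: gens_def)
  have "(\<lambda>q::nat \<Rightarrow> 'a. poly.coeff (root_poly A q) l - (if l = 0 then level q else 0)) \<in> subalg split_conf (gens {})"
    using * by (rule subalg_diff) (cases "l = 0", auto intro: subalg_gen subalg.const simp: gens_def)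
  then show ?case
    by (rule subalg.cong) (simp add: root_poly_B_level coeff_pCons split: nat.split)
next
  case (insert b C)
  define r where "r = (\<lambda>q::nat \<Rightarrow> 'a. root_poly (B - insert b C) q)"
  have split: "B - C = insert b (B - insert b C)" using insert.hyps(2) insert.prems by blast
  have p: "root_poly (B - C) q = [:- q b, 1:] * r q" for q
    unfolding r_def root_poly_def split by (subst prod.insert) auto
  have rec: "poly.coeff (r q) l = poly.coeff (root_poly (B - C) q) (Suc l) + q b * poly.coeff (r q) (Suc l)" for q l
    unfolding p by simp
  have IH: "(\<lambda>q::nat \<Rightarrow> 'a. poly.coeff (root_poly (B - C) q) l) \<in> subalg split_conf (gens (insert b C))" for l
    by (rule subalg_mono[OF insert.IH]) (use insert.prems in \<open>auto simp: gens_def\<close>)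
  have b: "(\<lambda>q::nat \<Rightarrow> 'a. q b) \<in> subalg split_conf (gens (insert b C))"
    by (intro subalg_gen) (auto simp: gens_def)
  have zero: "(\<lambda>q. poly.coeff (r q) l) \<in> subalg split_conf (gens (insert b C))" if "l > card B" for l
  proof -
    have "poly.coeff (r q) l = 0" for q
      unfolding r_def using that card_mono[OF finite_B, of "B - insert b C"]
      by (intro coeff_eq_0) auto
    then show ?thesis by (simp add: subalg.const)
  qed
  have "(\<lambda>q. poly.coeff (r q) (Suc (card B) - k)) \<in> subalg split_conf (gens (insert b C))" for k
  proof (induction k)
    case 0
    show ?case by (rule zero) simp
  next
    case (Suc k)
    show ?case
    proof (cases "k \<le> card B")
      case True
      then have up: "Suc (Suc (card B) - Suc k) = Suc (card B) - k" by simp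
      have "(\<lambda>q. poly.coeff (r q) (Suc (card B) - Suc k)) =
          (\<lambda>q. poly.coeff (root_poly (B - C) q) (Suc (card B) - k) + q b * poly.coeff (r q) (Suc (card B) - k))"
        unfolding rec[of _ "Suc (card B) - Suc k"] up ..
      then show ?thesis using subalg.add[OF IH subalg_mult[OF b Suc]] by (simp only:)
    next
      case False
      then show ?thesis using Suc by simp
    qed
  qed
  from this[of "Suc (card B) - l"] show ?case
    using zero[of l] by (cases "l \<le> Suc (card B)") (auto simp: r_def)
qed

text \<open>
  Every \<open>q\<^sub>b\<close> with \<open>b \<in> B - C\<close> is a root of a monic polynomial of degree \<open>card (B - C)\<close> whose coefficients
  lie in the smaller algebra, so higher powers of \<open>q\<^sub>b\<close> can be eliminated.
\<close>

lemma reduce_modulo_root_poly: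
  fixes f :: "(nat \<Rightarrow> 'a::field) \<Rightarrow> 'a"
  assumes "f \<in> subalg split_conf (gens (insert b C))" "C \<subseteq> B" "b \<in> B" "b \<notin> C"
  shows "\<exists>c. (\<forall>l. c l \<in> subalg split_conf (gens C)) \<and>
    (\<forall>q\<in>split_conf. f q = (\<Sum>l<card (B - C). c l q * q b ^ l))"
  using assms(1)
proof induction
  obtain m where n: "card (B - C) = Suc m"
    using assms by (metis DiffI card_eq_0_iff empty_iff finite_B finite_Diff not0_implies_Suc)
  {
    case (const c)
    have "c = (\<Sum>l<Suc m. (if l = 0 then c else 0) * q b ^ l)" for q
      by (subst sum.lessThan_Suc_shift) simp
    then show ?case
      unfolding n by (intro exI[of _ "\<lambda>l q. if l = 0 then c else 0"]) (auto intro: subalg.const)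
  next
    case (gen_mult s f)
    then obtain c where c: "\<And>l. c l \<in> subalg split_conf (gens C)"
      "\<And>q. q \<in> split_conf \<Longrightarrow> f q = (\<Sum>l<card (B - C). c l q * q b ^ l)" by blast
    show ?case
    proof (cases "s \<in> gens C")
      case True
      then show ?thesis
        using c by (intro exI[of _ "\<lambda>l q. s q * c l q"])
          (auto intro: subalg.gen_mult simp: sum_distrib_left mult.assoc)
    next
      case False
      then have s: "s = (\<lambda>q. q b)" using gen_mult(1) by (auto simp: gens_def)
      define h where "h = (\<lambda>l (q::nat \<Rightarrow> 'a). poly.coeff (root_poly (B - C) q) l)"
      have h: "h l \<in> subalg split_conf (gens C)" for l
        unfolding h_def by (rule coeff_root_poly_rest[OF finite_subset[OF assms(2) finite_B] assms(2)])
      have power: "q b ^ Suc m = - (\<Sum>l<Suc m. h l q * q b ^ l)" for q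
      proof -
        have "poly (root_poly (B - C) q) (q b) = 0"
          using assms by (auto simp: poly_root_poly)
        then have "0 = (\<Sum>l\<le>Suc m. h l q * q b ^ l)"
          by (simp add: poly_altdef h_def n)
        also have "\<dots> = (\<Sum>l<Suc m. h l q * q b ^ l) + q b ^ Suc m"
          using lead_coeff_root_poly[of "B - C" q] n
          by (simp add: h_def lessThan_Suc_atMost[symmetric])
        finally show ?thesis by (rule minus_unique[OF sym, symmetric])
      qed
      \<comment> \<open>Multiplication by \<open>q\<^sub>b\<close> shifts the coefficients, and the overflow \<open>c\<^sub>m q\<^sub>b\<^bsup>m+1\<^esup>\<close> is reduced by the monic equation.\<close>
      define c' where "c' = (\<lambda>l q. (if l = 0 then 0 else c (l - 1) q) - c m q * h l q)"
      have "c' l \<in> subalg split_conf (gens C)" for l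
      proof -
        have "(\<lambda>q. if l = 0 then 0 else c (l - 1) q) \<in> subalg split_conf (gens C)"
          using c(1) by (cases "l = 0") (simp_all add: subalg.const)
        then show ?thesis
          unfolding c'_def by (intro subalg_diff subalg_mult c(1) h)
      qed
      moreover have "s q * f q = (\<Sum>l<card (B - C). c' l q * q b ^ l)" if "q \<in> split_conf" for q
      proof -
        have "s q * f q = (\<Sum>l<Suc m. c l q * q b ^ Suc l)"
          using c(2)[OF that] by (simp add: s n sum_distrib_left mult_ac del: sum.lessThan_Suc)
        also have "\<dots> = (\<Sum>l<m. c l q * q b ^ Suc l) + c m q * q b ^ Suc m"
          by simp
        also have "(\<Sum>l<m. c l q * q b ^ Suc l) = (\<Sum>l<Suc m. (if l = 0 then 0 else c (l - 1) q) * q b ^ l)"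
          by (subst sum.lessThan_Suc_shift) simp
        also have "c m q * q b ^ Suc m = - (\<Sum>l<Suc m. c m q * h l q * q b ^ l)"
          unfolding power by (simp add: sum_distrib_left mult.assoc del: sum.lessThan_Suc)
        finally show ?thesis
          by (simp add: n c'_def sum_subtractf left_diff_distrib del: sum.lessThan_Suc)
      qed
      ultimately show ?thesis by blast
    qed
  next
    case (add f g)
    then obtain c c' where "\<forall>l. c l \<in> subalg split_conf (gens C)" "\<forall>l. c' l \<in> subalg split_conf (gens C)"
      "\<forall>q\<in>split_conf. f q = (\<Sum>l<card (B - C). c l q * q b ^ l)"
      "\<forall>q\<in>split_conf. g q = (\<Sum>l<card (B - C). c' l q * q b ^ l)" by blast
    then show ?case
      by (intro exI[of _ "\<lambda>l q. c l q + c' l q"]) (auto intro: subalg.add simp: sum.distrib distrib_right)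
  next
    case (cong f g)
    then show ?case by auto
  }
qed

lemma subalg_gens_permute:
  assumes "g \<in> subalg split_conf (gens C)" "C \<subseteq> B" "\<sigma> permutes (B - C)" "q \<in> split_conf"
  shows "g (q \<circ> \<sigma>) = g q"
proof -
  have \<sigma>: "\<sigma> permutes B" using assms(3) by (rule permutes_subset) blast
  from assms(1) show ?thesis
  proof induction
    case (gen_mult s f)
    have "s (q \<circ> \<sigma>) = s q"
    proof (cases "s = level")
      case False
      then obtain i where i: "s = (\<lambda>q. q i)" "i \<in> A \<union> C" using gen_mult(1) by (auto simp: gens_def)
      then have "\<sigma> i = i" using assms(2) disjoint permutes_not_in[OF assms(3), of i] by blast
      then show ?thesis by (simp add: i)
    qed (simp add: level_perm[OF assms(4) \<sigma>])
    then show ?case by (simp only: gen_mult.IH)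
  next
    case (cong f g)
    then show ?case using split_conf_perm[OF assms(4) \<sigma>] assms(4) by metis
  qed simp_all
qed

text \<open>
  Write \<open>f = \<Sum>\<^sub>l c\<^sub>l q\<^sub>b\<^sup>l\<close> with \<open>l < card (B - C)\<close>.  Swapping \<open>b\<close> with another element \<open>b'\<close> of \<open>B - C\<close> changes neither \<open>f\<close> nor the
  coefficients, so the polynomial \<open>\<Sum>\<^sub>l c\<^sub>l T\<^sup>l\<close> takes the value \<open>f\<close> at all the distinct points \<open>q\<^sub>b'\<close>, one more than its degree
  allows unless it is constant.  Hence \<open>f = c\<^sub>0\<close>.
\<close>

lemma descend_one_coordinate:
  fixes f :: "(nat \<Rightarrow> 'a::field) \<Rightarrow> 'a"
  assumes f: "f \<in> subalg split_conf (gens (insert b C))" and C: "C \<subseteq> B" "b \<in> B" "b \<notin> C"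
    and inv: "\<And>q \<sigma>. q \<in> split_conf \<Longrightarrow> \<sigma> permutes B \<Longrightarrow> f (q \<circ> \<sigma>) = f q"
  shows "f \<in> subalg split_conf (gens C)"
proof -
  obtain c where c: "\<And>l. c l \<in> subalg split_conf (gens C)"
    "\<And>q. q \<in> split_conf \<Longrightarrow> f q = (\<Sum>l<card (B - C). c l q * q b ^ l)"
    using reduce_modulo_root_poly[OF f C] by blast
  have n: "card (B - C) > 0" using C by (auto simp: card_gt_0_iff)
  have "c 0 q = f q" if q: "q \<in> split_conf" for q
  proof -
    define p where "p = (\<Sum>l<card (B - C). Polynomial.monom (c l q) l)"
    have val: "poly p (q b') = f q" if b': "b' \<in> B - C" for b'
    proof -
      define \<tau> where "\<tau> = Transposition.transpose b b'"
      have \<tau>: "\<tau> permutes (B - C)"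
        unfolding \<tau>_def using b' C by (intro permutes_swap_id) auto
      then have \<tau>B: "\<tau> permutes B" by (rule permutes_subset) blast
      have "f q = (\<Sum>l<card (B - C). c l (q \<circ> \<tau>) * (q \<circ> \<tau>) b ^ l)"
        using inv[OF q \<tau>B] c(2)[OF split_conf_perm[OF q \<tau>B]] by simp
      also have "\<dots> = (\<Sum>l<card (B - C). c l q * q b' ^ l)"
        using subalg_gens_permute[OF c(1) C(1) \<tau> q] by (simp add: \<tau>_def)
      finally show ?thesis by (simp add: p_def poly_sum poly_monom)
    qed
    have "p = [:f q:]"
    proof (rule poly_eqI_degree[of "q ` (B - C)"])
      have card: "card (q ` (B - C)) = card (B - C)"
        using split_confD(2)[OF q] by (intro card_image) (rule inj_on_subset, auto)
      have "Polynomial.degree p \<le> card (B - C) - 1"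
        unfolding p_def by (intro degree_sum_le) (auto intro: order_trans[OF degree_monom_le])
      then show "Polynomial.degree p < card (q ` (B - C))" using n card by linarith
      show "Polynomial.degree [:f q:] < card (q ` (B - C))" using n card by simp
    qed (use val in auto)
    then have "poly.coeff p 0 = f q" by simp
    moreover have "poly.coeff p 0 = c 0 q"
      using n by (simp add: p_def coeff_sum sum.delta)
    ultimately show ?thesis by simp
  qed
  then show ?thesis using subalg.cong[OF c(1)] by blast
qed

text \<open>
  This is a form of the fundamental theorem of symmetric polynomials, with the elementary symmetric functions of \<open>x\<^sub>B\<close>
  expressed through \<open>x\<^sub>A\<close> and the level.  Distinctness of the coordinates makes a pointwise proof possible.
\<close>

lemma invariants_descend:
  fixes f :: "(nat \<Rightarrow> 'a::field) \<Rightarrow> 'a"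
  assumes "f \<in> poly_funs (2*d)"
    and inv: "\<And>q \<sigma>. q \<in> split_conf \<Longrightarrow> \<sigma> permutes B \<Longrightarrow> f (q \<circ> \<sigma>) = f q"
  shows "f \<in> subalg split_conf (gens {})"
proof -
  have "f \<in> subalg split_conf (gens B)"
    using assms(1)
    by induction (auto intro: subalg.const subalg.add subalg_mult subalg_gen simp: gens_def union)
  moreover have "f \<in> subalg split_conf (gens C) \<Longrightarrow> f \<in> subalg split_conf (gens {})"
    if "finite C" "C \<subseteq> B" for C
    using that
  proof (induction C rule: finite_induct)
    case (insert b C)
    have "f \<in> subalg split_conf (gens C)"
      using insert by (intro descend_one_coordinate[of f b C] inv) auto
    then show ?case using insert by auto
  qed
  ultimately show ?thesis using finite_B by blast
qed


section \<open>The base of the finite projection\<close>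

lemma subalg_factor_through_base:
  fixes f :: "(nat \<Rightarrow> 'a::field) \<Rightarrow> 'a"
  assumes "f \<in> subalg split_conf (gens {})"
  shows "\<exists>\<Phi> \<in> subalg UNIV (insert snd ((\<lambda>a p. fst p a) ` A)). \<forall>q\<in>split_conf. f q = \<Phi> (q, level q)"
  using assms
proof induction
  case (const c)
  show ?case by (rule bexI[of _ "\<lambda>p. c"]) (auto intro: subalg.const)
next
  case (gen_mult s f)
  then obtain \<Phi> where \<Phi>: "\<Phi> \<in> subalg UNIV (insert snd ((\<lambda>a p. fst p a) ` A))"
    "\<forall>q\<in>split_conf. f q = \<Phi> (q, level q)" by blast
  have "\<exists>t \<in> insert snd ((\<lambda>a p. fst p a) ` A). \<forall>q. s q = t (q, level q)"
    using gen_mult(1) by (auto simp: gens_def)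
  then obtain t where t: "t \<in> insert snd ((\<lambda>a p. fst p a) ` A)" "\<And>q. s q = t (q, level q)" by blast
  show ?case
    by (rule bexI[OF _ subalg.gen_mult[OF t(1) \<Phi>(1)]]) (simp add: t(2) \<Phi>(2))
next
  case (add f g)
  then obtain \<Phi> \<Psi> where \<Phi>: "\<Phi> \<in> subalg UNIV (insert snd ((\<lambda>a p. fst p a) ` A))"
    "\<forall>q\<in>split_conf. f q = \<Phi> (q, level q)"
    and \<Psi>: "\<Psi> \<in> subalg UNIV (insert snd ((\<lambda>a p. fst p a) ` A))"
    "\<forall>q\<in>split_conf. g q = \<Psi> (q, level q)" by blast
  show ?case
    by (rule bexI[OF _ subalg.add[OF \<Phi>(1) \<Psi>(1)]]) (simp add: \<Psi>(2) \<Phi>(2))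
next
  case (cong f g)
  then show ?case by metis
qed

lemma base_fun_local:
  fixes \<Phi> :: "(nat \<Rightarrow> 'a::field) \<times> 'a \<Rightarrow> 'a"
  assumes "\<Phi> \<in> subalg UNIV (insert snd ((\<lambda>a p. fst p a) ` A))" "\<forall>a\<in>A. x a = y a"
  shows "\<Phi> (x, c) = \<Phi> (y, c)"
  using assms(1) by induction (use assms(2) in auto)

text \<open>
  The roots of \<open>g\<^sub>A - c\<close> can serve as the points of \<open>B\<close> whenever they are simple and \<open>c \<noteq> 0\<close>.  Multiple roots occur only when
  \<open>c\<close> is a critical value of \<open>g\<^sub>A\<close>.  In every characteristic \<open>g\<^sub>A\<close> has only finitely many critical values, since having a simple
  root it has a nonzero derivative.
\<close>

lemma exists_split_conf_over:
  fixes x :: "nat \<Rightarrow> 'a::alg_closed_field"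
  assumes inj: "inj_on x A"
  shows "finite {c. \<not> (\<exists>q\<in>split_conf. (\<forall>a\<in>A. q a = x a) \<and> level q = c)}"
proof -
  define g where "g = root_poly A x"
  have "pderiv g \<noteq> 0"
  proof
    assume g': "pderiv g = 0"
    obtain a where a: "a \<in> A" using A_nonempty by blast
    define h where "h = root_poly (A - {a}) x"
    have gh: "g = [:- x a, 1:] * h"
      unfolding g_def h_def root_poly_def by (rule prod.remove[OF finite_A a])
    have "pderiv [:- x a, 1:] = 1" by (simp add: pderiv_pCons)
    then have "poly h (x a) = poly (pderiv g) (x a)"
      unfolding gh pderiv_mult by (simp del: mult_pCons_left)
    then have "(\<Prod>i\<in>A - {a}. x a - x i) = 0" by (simp add: g' h_def poly_root_poly)
    then obtain i where "i \<in> A - {a}" "x a = x i" by auto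
    then show False using inj_onD[OF inj] a by blast
  qed
  then have fin: "finite (insert 0 (poly g ` {r. poly (pderiv g) r = 0}))"
    using poly_roots_finite by blast
  have "\<exists>q\<in>split_conf. (\<forall>a\<in>A. q a = x a) \<and> level q = c"
    if c: "c \<notin> insert 0 (poly g ` {r. poly (pderiv g) r = 0})" for c
  proof -
    define p where "p = g - [:c:]"
    have deg_g: "Polynomial.degree g = d" by (simp add: g_def card_A)
    have deg_p: "Polynomial.degree p = d"
      unfolding p_def using deg_g d_pos by (simp add: degree_diff_const)
    have "p \<noteq> 0" using deg_p d_pos by auto
    have val: "poly p r = 0 \<longleftrightarrow> poly g r = c" for r by (simp add: p_def)
    have "pderiv p = pderiv g" by (simp add: p_def pderiv_diff pderiv_pCons)
    then have "card {r. poly p r = 0} = d"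
      using c val deg_p card_roots_separable[OF \<open>p \<noteq> 0\<close>] by auto
    then obtain \<phi> where \<phi>: "bij_betw \<phi> B {r. poly p r = 0}"
      using finite_same_card_bij[OF finite_B poly_roots_finite[OF \<open>p \<noteq> 0\<close>]] card_B by auto
    define q where "q = (\<lambda>i. if i \<in> A then x i else if i \<in> B then \<phi> i else undefined)"
    have qA: "q a = x a" if "a \<in> A" for a using that by (simp add: q_def)
    have qB: "q b = \<phi> b" if "b \<in> B" for b using that disjoint by (auto simp: q_def)
    have root: "poly g (\<phi> b) = c" if "b \<in> B" for b
      using bij_betwE[OF \<phi>] that val by blast
    have prod: "(\<Prod>a\<in>A. q b - q a) = c" if "b \<in> B" for b
      using root[OF that] unfolding g_def poly_root_poly qB[OF that] by (simp add: qA)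
    have "q \<in> affine_space (2*d)"
      unfolding q_def union[symmetric] by (rule PiE_I) auto
    moreover have "inj_on q (A \<union> B)"
    proof -
      have 1: "inj_on q A" using inj qA by (simp cong: inj_on_cong)
      have 2: "inj_on q B" using bij_betw_imp_inj_on[OF \<phi>] qB by (simp cong: inj_on_cong)
      have 3: "q a \<noteq> q b" if "a \<in> A" "b \<in> B" for a b
      proof
        assume "q a = q b"
        then have "(\<Prod>a\<in>A. q b - q a) = 0"
          by (intro prod_zero[OF finite_A] bexI[OF _ that(1)]) simp
        then show False using prod[OF that(2)] c by simp
      qed
      show ?thesis
      proof (rule inj_onI)
        fix i j assume "i \<in> A \<union> B" "j \<in> A \<union> B" "q i = q j"
        then show "i = j" using 3[of i j] 3[of j i] inj_onD[OF 1, of i j] inj_onD[OF 2, of i j] by auto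
      qed
    qed
    ultimately have "q \<in> split_conf"
      using prod unfolding split_conf_def Conf_def union by blast
    moreover have "level q = c" using level_eq[OF calculation some_B] prod[OF some_B] by simp
    ultimately show ?thesis using qA by blast
  qed
  then show ?thesis by (intro finite_subset[OF _ fin]) blast
qed

lemma split_conf_nonempty: "(split_conf :: (nat \<Rightarrow> 'a::alg_closed_field) set) \<noteq> {}"
proof -
  obtain R :: "'a set" where R: "finite R" "card R = d"
    using infinite_arbitrarily_large[OF infinite_UNIV_alg_closed] by blast
  then obtain x :: "nat \<Rightarrow> 'a" where "bij_betw x A R"
    using finite_same_card_bij[OF finite_A R(1)] card_A by auto
  then have "finite {c. \<not> (\<exists>q\<in>split_conf. (\<forall>a\<in>A. q a = x a) \<and> level q = c)}"
    by (intro exists_split_conf_over bij_betw_imp_inj_on)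
  then show ?thesis using ex_new_if_finite[OF infinite_UNIV_alg_closed] by blast
qed

definition fixing :: "nat set \<Rightarrow> (nat \<Rightarrow> 'a::field) \<Rightarrow> (nat \<Rightarrow> 'a) set" where
  "fixing E u = {q \<in> split_conf. \<forall>a\<in>E. q a = u a}"

text \<open>
  The two points are joined in two stages.  Along the line from \<open>y\<^sub>1\<close> to \<open>y\<^sub>2\<close> in the \<open>x\<^sub>A\<close>-coordinates, with the levels frozen,
  both functions are nonzero polynomials in the parameter; then, over a good point of the line, both are nonzero
  polynomials in the level.  Varying the level last means that only the critical values of one separable polynomial have to
  be avoided, so that no discriminant is needed.
\<close>

lemma invariants_both_nonzero:
  fixes f\<^sub>1 f\<^sub>2 :: "(nat \<Rightarrow> 'a::alg_closed_field) \<Rightarrow> 'a"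
  assumes f: "f\<^sub>1 \<in> subalg split_conf (gens {})" "f\<^sub>2 \<in> subalg split_conf (gens {})"
    and E: "E \<subseteq> A" and y: "y\<^sub>1 \<in> fixing E u" "y\<^sub>2 \<in> fixing E u" "f\<^sub>1 y\<^sub>1 \<noteq> 0" "f\<^sub>2 y\<^sub>2 \<noteq> 0"
  shows "\<exists>y\<in>fixing E u. f\<^sub>1 y \<noteq> 0 \<and> f\<^sub>2 y \<noteq> 0"
proof -
  let ?S = "insert snd ((\<lambda>a p. fst p a) ` A) :: ((nat \<Rightarrow> 'a) \<times> 'a \<Rightarrow> 'a) set"
  have yV: "y\<^sub>1 \<in> split_conf" "y\<^sub>2 \<in> split_conf" using y unfolding fixing_def by blast+
  obtain \<Phi>\<^sub>1 where \<Phi>\<^sub>1: "\<Phi>\<^sub>1 \<in> subalg UNIV ?S" "\<And>q. q \<in> split_conf \<Longrightarrow> f\<^sub>1 q = \<Phi>\<^sub>1 (q, level q)"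
    using subalg_factor_through_base[OF f(1)] by blast
  obtain \<Phi>\<^sub>2 where \<Phi>\<^sub>2: "\<Phi>\<^sub>2 \<in> subalg UNIV ?S" "\<And>q. q \<in> split_conf \<Longrightarrow> f\<^sub>2 q = \<Phi>\<^sub>2 (q, level q)"
    using subalg_factor_through_base[OF f(2)] by blast
  define x where "x = (\<lambda>t a. y\<^sub>1 a + t * (y\<^sub>2 a - y\<^sub>1 a))"
  have x_ends: "x 0 = y\<^sub>1" "x 1 = y\<^sub>2" by (auto simp: x_def)
  have line: "\<exists>p. \<forall>t. \<Phi> (x t, c) = poly p t" if "\<Phi> \<in> subalg UNIV ?S" for \<Phi> c
  proof (rule subalg_polynomial_along_curve[OF that])
    fix s assume "s \<in> ?S"
    then consider "s = snd" | a where "s = (\<lambda>p. fst p a)" by blast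
    then show "\<exists>p. \<forall>t. s (x t, c) = poly p t"
    proof cases
      case 1
      then show ?thesis by (intro exI[of _ "[:c:]"]) simp
    next
      case 2
      then show ?thesis
        by (intro exI[of _ "[:y\<^sub>1 a, y\<^sub>2 a - y\<^sub>1 a:]"]) (simp add: x_def)
    qed
  qed
  have vertical: "\<exists>p. \<forall>c. \<Phi> (z, c) = poly p c" if "\<Phi> \<in> subalg UNIV ?S" for \<Phi> z
  proof (rule subalg_polynomial_along_curve[OF that])
    fix s assume "s \<in> ?S"
    then consider "s = snd" | a where "s = (\<lambda>p. fst p a)" by blast
    then show "\<exists>p. \<forall>c. s (z, c) = poly p c"
    proof cases
      case 1
      then show ?thesis by (intro exI[of _ "[:0, 1:]"]) simp
    next
      case 2
      then show ?thesis by (intro exI[of _ "[:z a:]"]) simp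
    qed
  qed
  have fin: "finite {t. poly p t = 0}" if "poly p t \<noteq> 0" for p :: "'a poly" and t
    using that by (intro poly_roots_finite) auto
  obtain p\<^sub>1 where p\<^sub>1: "\<And>t. \<Phi>\<^sub>1 (x t, level y\<^sub>1) = poly p\<^sub>1 t" using line[OF \<Phi>\<^sub>1(1)] by metis
  obtain p\<^sub>2 where p\<^sub>2: "\<And>t. \<Phi>\<^sub>2 (x t, level y\<^sub>2) = poly p\<^sub>2 t" using line[OF \<Phi>\<^sub>2(1)] by metis
  have "poly p\<^sub>1 0 \<noteq> 0" unfolding p\<^sub>1[symmetric] x_ends \<Phi>\<^sub>1(2)[OF yV(1), symmetric] by (rule y(3))
  then have fin1: "finite {t. poly p\<^sub>1 t = 0}" by (rule fin)
  have "poly p\<^sub>2 1 \<noteq> 0" unfolding p\<^sub>2[symmetric] x_ends \<Phi>\<^sub>2(2)[OF yV(2), symmetric] by (rule y(4))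
  then have fin2: "finite {t. poly p\<^sub>2 t = 0}" by (rule fin)
  have coll: "finite {t. x t a = x t a'}" if "a \<in> A" "a' \<in> A" "a \<noteq> a'" for a a'
  proof -
    define p where "p = [:y\<^sub>1 a - y\<^sub>1 a', (y\<^sub>2 a - y\<^sub>1 a) - (y\<^sub>2 a' - y\<^sub>1 a'):]"
    have "{t. x t a = x t a'} = {t. poly p t = 0}"
      unfolding x_def p_def by (simp add: algebra_simps)
    moreover have "poly p 0 \<noteq> 0"
      unfolding p_def using inj_on_contraD[OF split_confD(1)[OF yV(1)] that(3,1,2)] by simp
    ultimately show ?thesis using fin by (simp only:)
  qed
  have "finite (\<Union>a\<in>A. \<Union>a'\<in>A - {a}. {t. x t a = x t a'})"
    by (intro finite_UN_I finite_A finite_Diff coll) simp_all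
  then obtain t where t: "t \<notin> {t. poly p\<^sub>1 t = 0} \<union> {t. poly p\<^sub>2 t = 0} \<union>
      (\<Union>a\<in>A. \<Union>a'\<in>A - {a}. {t. x t a = x t a'})"
    using ex_new_if_finite[OF infinite_UNIV_alg_closed finite_UnI[OF finite_UnI[OF fin1 fin2]]] by blast
  have "inj_on (x t) A"
  proof (rule inj_onI, rule ccontr)
    fix a a' assume "a \<in> A" "a' \<in> A" "x t a = x t a'" "a \<noteq> a'"
    then have "t \<in> (\<Union>a\<in>A. \<Union>a'\<in>A - {a}. {t. x t a = x t a'})" by blast
    then show False using t by blast
  qed
  then have fin3: "finite {c. \<not> (\<exists>q\<in>split_conf. (\<forall>a\<in>A. q a = x t a) \<and> level q = c)}"
    by (rule exists_split_conf_over)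
  obtain r\<^sub>1 where r\<^sub>1: "\<And>c. \<Phi>\<^sub>1 (x t, c) = poly r\<^sub>1 c" using vertical[OF \<Phi>\<^sub>1(1)] by metis
  obtain r\<^sub>2 where r\<^sub>2: "\<And>c. \<Phi>\<^sub>2 (x t, c) = poly r\<^sub>2 c" using vertical[OF \<Phi>\<^sub>2(1)] by metis
  have "poly r\<^sub>1 (level y\<^sub>1) \<noteq> 0" using t unfolding r\<^sub>1[symmetric] p\<^sub>1 by blast
  then have fin4: "finite {c. poly r\<^sub>1 c = 0}" by (rule fin)
  have "poly r\<^sub>2 (level y\<^sub>2) \<noteq> 0" using t unfolding r\<^sub>2[symmetric] p\<^sub>2 by blast
  then have fin5: "finite {c. poly r\<^sub>2 c = 0}" by (rule fin)
  obtain c where c: "c \<notin> {c. \<not> (\<exists>q\<in>split_conf. (\<forall>a\<in>A. q a = x t a) \<and> level q = c)} \<union>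
      {c. poly r\<^sub>1 c = 0} \<union> {c. poly r\<^sub>2 c = 0}"
    using ex_new_if_finite[OF infinite_UNIV_alg_closed finite_UnI[OF finite_UnI[OF fin3 fin4] fin5]] by blast
  then obtain q where q: "q \<in> split_conf" "\<forall>a\<in>A. q a = x t a" "level q = c" by blast
  have "q a = u a" if "a \<in> E" for a
  proof -
    have "y\<^sub>1 a = u a" "y\<^sub>2 a = u a" using y that unfolding fixing_def by blast+
    moreover have "q a = x t a" using q(2) E that by blast
    ultimately show ?thesis by (simp add: x_def)
  qed
  then have "q \<in> fixing E u" using q(1) unfolding fixing_def by blast
  moreover have "f\<^sub>1 q \<noteq> 0"
    using c unfolding \<Phi>\<^sub>1(2)[OF q(1)] q(3) base_fun_local[OF \<Phi>\<^sub>1(1) q(2)] r\<^sub>1 by blast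
  moreover have "f\<^sub>2 q \<noteq> 0"
    using c unfolding \<Phi>\<^sub>2(2)[OF q(1)] q(3) base_fun_local[OF \<Phi>\<^sub>2(1) q(2)] r\<^sub>2 by blast
  ultimately show ?thesis by blast
qed

section \<open>Irreducible sets over the strata\<close>

abbreviation split_top :: "(nat \<Rightarrow> 'a::field) topology" where
  "split_top \<equiv> subtopology (zariski (2*d)) split_conf"

lemma split_conf_sub: "split_conf \<subseteq> affine_space (2*d)"
  unfolding split_conf_def Conf_def by blast

lemma topspace_split_top: "topspace split_top = split_conf"
  using split_conf_sub by auto

lemma closedin_split_top:
  "closedin split_top Z \<longleftrightarrow> (\<exists>F \<subseteq> poly_funs (2*d). Z = {q \<in> split_conf. \<forall>f\<in>F. f q = 0})"
proof -
  have "zero_locus (2*d) F \<inter> split_conf = {q \<in> split_conf. \<forall>f\<in>F. f q = 0}" for F :: "((nat \<Rightarrow> 'a) \<Rightarrow> 'a) set"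
    using split_conf_sub unfolding zero_locus_def by blast
  then show ?thesis unfolding closedin_subtopology closedin_zariski by metis
qed

lemma poly_funs_permute:
  assumes "f \<in> poly_funs (2*d)" "\<sigma> permutes B"
  shows "(\<lambda>q. f (q \<circ> \<sigma>)) \<in> poly_funs (2*d)"
  using assms(1)
proof induction
  case (coord i)
  have "\<sigma> permutes {1..2*d}" using assms(2) by (rule permutes_subset) (use union in blast)
  then have "\<sigma> i \<in> {1..2*d}" using coord by (simp only: permutes_in_image)
  then show ?case using poly_funs.coord by simp
qed (auto intro: poly_funs.const poly_funs.add poly_funs.mult)

text \<open>
  First multiply, over \<open>\<sigma> \<in> G\<close>, functions vanishing on \<open>C\<close> but not at \<open>y \<circ> \<sigma>\<close>, pulled back along \<open>\<sigma>\<close>.  The product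
  \<open>f\<^sub>0\<close> vanishes on the whole saturation of \<open>C\<close> and not at \<open>y\<close>, but it need not be invariant, and its norm
  \<open>\<Prod>\<^sub>\<tau> f\<^sub>0(q \<circ> \<tau>)\<close> may vanish at \<open>y\<close>.  Shifting by the scalar \<open>f\<^sub>0 y\<close> cures this: \<open>\<Prod>\<^sub>\<tau> (f\<^sub>0(q \<circ> \<tau>) - f\<^sub>0 y)\<close> is
  \<open>(- f\<^sub>0 y)\<^sup>|G|\<close> on \<open>C\<close> and \<open>0\<close> at \<open>y\<close>, so that subtracting this power gives the required invariant.
\<close>

lemma separating_invariant:
  fixes y :: "nat \<Rightarrow> 'a::field"
  assumes C: "closedin split_top C" and y: "y \<in> split_conf"
    and avoid: "\<And>\<sigma>. \<sigma> permutes B \<Longrightarrow> y \<circ> \<sigma> \<notin> C"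
  shows "\<exists>f \<in> subalg split_conf (gens {}). f y \<noteq> 0 \<and>
    (\<forall>q\<in>split_conf. \<forall>\<sigma>. \<sigma> permutes B \<and> q \<circ> \<sigma> \<in> C \<longrightarrow> f q = 0)"
proof -
  let ?G = "{\<sigma>. \<sigma> permutes B}"
  have finG: "finite ?G" by (rule finite_permutations) simp
  obtain F where F: "F \<subseteq> poly_funs (2*d)" "C = {q \<in> split_conf. \<forall>f\<in>F. f q = 0}"
    using C unfolding closedin_split_top by blast
  have "\<forall>\<sigma>\<in>?G. \<exists>f. f \<in> F \<and> f (y \<circ> \<sigma>) \<noteq> 0"
  proof
    fix \<sigma> assume "\<sigma> \<in> ?G"
    then have "y \<circ> \<sigma> \<notin> C" "y \<circ> \<sigma> \<in> split_conf" using avoid split_conf_perm[OF y] by simp_all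
    then show "\<exists>f. f \<in> F \<and> f (y \<circ> \<sigma>) \<noteq> 0" unfolding F(2) by blast
  qed
  from bchoice[OF this] obtain \<phi> where "\<forall>\<sigma>\<in>?G. \<phi> \<sigma> \<in> F \<and> \<phi> \<sigma> (y \<circ> \<sigma>) \<noteq> 0" ..
  then have \<phi>: "\<phi> \<sigma> \<in> F" "\<phi> \<sigma> (y \<circ> \<sigma>) \<noteq> 0" if "\<sigma> \<in> ?G" for \<sigma>
    using that by blast+
  define f\<^sub>0 where "f\<^sub>0 = (\<lambda>q. \<Prod>\<sigma>\<in>?G. \<phi> \<sigma> (q \<circ> \<sigma>))"
  define f where "f = (\<lambda>q. (\<Prod>\<tau>\<in>?G. f\<^sub>0 (q \<circ> \<tau>) - f\<^sub>0 y) - (- f\<^sub>0 y) ^ card ?G)"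
  have "(\<lambda>q. \<phi> \<sigma> (q \<circ> \<sigma>)) \<in> poly_funs (2*d)" if "\<sigma> \<in> ?G" for \<sigma>
    by (rule poly_funs_permute) (use \<phi>(1)[OF that] F(1) that in blast)+
  then have f\<^sub>0: "f\<^sub>0 \<in> poly_funs (2*d)"
    unfolding f\<^sub>0_def by (rule poly_funs_prod)
  have "(\<lambda>q. f\<^sub>0 (q \<circ> \<tau>) - f\<^sub>0 y) \<in> poly_funs (2*d)" if "\<tau> \<in> ?G" for \<tau>
    by (rule poly_funs_diff[OF poly_funs_permute[OF f\<^sub>0] poly_funs.const]) (use that in blast)
  then have "f \<in> poly_funs (2*d)"
    unfolding f_def by (intro poly_funs_diff[OF poly_funs_prod poly_funs.const])
  moreover have "f (q \<circ> \<sigma>) = f q" if "\<sigma> permutes B" for q \<sigma>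
  proof -
    have "bij_betw ((\<circ>) \<sigma>) ?G ?G"
      unfolding bij_betw_def
    proof
      show "inj_on ((\<circ>) \<sigma>) ?G"
        by (rule inj_on_inverseI[of _ "(\<circ>) (inv_into UNIV \<sigma>)"])
          (simp only: comp_assoc[symmetric] permutes_inv_o(2)[OF that] id_comp)
      show "(\<circ>) \<sigma> ` ?G = ?G"
        unfolding image_Collect image_compose_permutations_left[OF that] ..
    qed
    from prod.reindex_bij_betw[OF this, of "\<lambda>\<tau>. f\<^sub>0 (q \<circ> \<tau>) - f\<^sub>0 y"] show ?thesis
      unfolding f_def comp_assoc by simp
  qed
  ultimately have "f \<in> subalg split_conf (gens {})" by (intro invariants_descend)
  moreover have "f y \<noteq> 0"
  proof -
    have "f\<^sub>0 y \<noteq> 0" unfolding f\<^sub>0_def prod_zero_iff[OF finG] using \<phi>(2) by blast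
    moreover have "(\<Prod>\<tau>\<in>?G. f\<^sub>0 (y \<circ> \<tau>) - f\<^sub>0 y) = 0"
    proof (rule prod_zero[OF finG], rule bexI)
      show "f\<^sub>0 (y \<circ> id) - f\<^sub>0 y = 0" by (simp only: comp_id diff_self)
      show "id \<in> ?G" using permutes_id by blast
    qed
    ultimately show ?thesis unfolding f_def by simp
  qed
  moreover have "f q = 0" if q: "q \<in> split_conf" and \<sigma>: "\<sigma> permutes B" "q \<circ> \<sigma> \<in> C" for q \<sigma>
  proof -
    have zero: "f\<^sub>0 (q \<circ> \<tau>) = 0" if \<tau>: "\<tau> \<in> ?G" for \<tau>
      unfolding f\<^sub>0_def
    proof (rule prod_zero[OF finG], rule bexI)
      have \<tau>': "\<tau> permutes B" using \<tau> by simp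
      show *: "inv_into UNIV \<tau> \<circ> \<sigma> \<in> ?G"
        using permutes_compose[OF \<sigma>(1) permutes_inv[OF \<tau>']] by simp
      have "q \<circ> \<tau> \<circ> (inv_into UNIV \<tau> \<circ> \<sigma>) = q \<circ> (\<tau> \<circ> inv_into UNIV \<tau>) \<circ> \<sigma>" by (simp only: comp_assoc)
      then have "q \<circ> \<tau> \<circ> (inv_into UNIV \<tau> \<circ> \<sigma>) \<in> C"
        using \<sigma>(2) by (simp only: permutes_inv_o(1)[OF \<tau>'] comp_id)
      then show "\<phi> (inv_into UNIV \<tau> \<circ> \<sigma>) (q \<circ> \<tau> \<circ> (inv_into UNIV \<tau> \<circ> \<sigma>)) = 0"
        using \<phi>(1)[OF *] unfolding F(2) by blast
    qed
    have "(\<Prod>\<tau>\<in>?G. f\<^sub>0 (q \<circ> \<tau>) - f\<^sub>0 y) = (\<Prod>\<tau>\<in>?G. - f\<^sub>0 y)"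
      by (rule prod.cong[OF refl]) (simp only: zero diff_0)
    then show ?thesis unfolding f_def by (simp only: prod_constant) simp
  qed
  ultimately show ?thesis by blast
qed

definition meets_orbits :: "(nat \<Rightarrow> 'a) set \<Rightarrow> (nat \<Rightarrow> 'a) set \<Rightarrow> bool" where
  "meets_orbits Y C \<longleftrightarrow> (\<forall>y\<in>Y. \<exists>\<sigma>. \<sigma> permutes B \<and> y \<circ> \<sigma> \<in> C)"

text \<open>
  Zorn's lemma, applied to complements.  In a chain of closed sets meeting the orbit of \<open>y\<close>, one that meets it in the fewest permutations
  meets it in permutations common to all members, because there are only finitely many; hence the intersection meets it too.
\<close>

lemma exists_minimal_meeting_orbits:
  assumes "closedin T C" "meets_orbits Y C"
  shows "\<exists>Z\<subseteq>C. closedin T Z \<and> meets_orbits Y Z \<and>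
    (\<forall>Z'\<subseteq>Z. closedin T Z' \<and> meets_orbits Y Z' \<longrightarrow> Z' = Z)"
proof -
  let ?\<Z> = "{Z. Z \<subseteq> C \<and> closedin T Z \<and> meets_orbits Y Z}"
  have "\<exists>M\<in>uminus ` ?\<Z>. \<forall>N\<in>uminus ` ?\<Z>. M \<subseteq> N \<longrightarrow> N = M"
  proof (rule subset_Zorn)
    fix \<K> assume chain: "subset.chain (uminus ` ?\<Z>) \<K>"
    show "\<exists>U\<in>uminus ` ?\<Z>. \<forall>N\<in>\<K>. N \<subseteq> U"
    proof (cases "\<K> = {}")
      case True
      have "C \<in> ?\<Z>" using assms by blast
      then show ?thesis using True by blast
    next
      case False
      define \<C> where "\<C> = uminus ` \<K>"
      have "\<K> \<subseteq> uminus ` ?\<Z>" using chain unfolding subset.chain_def by blast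
      then have \<C>: "\<C> \<noteq> {}" "\<C> \<subseteq> ?\<Z>"
        using False unfolding \<C>_def by force+
      have total: "Z \<subseteq> Z' \<or> Z' \<subseteq> Z" if ZZ: "Z \<in> \<C>" "Z' \<in> \<C>" for Z Z'
      proof -
        obtain N where N: "N \<in> \<K>" "Z = - N" using ZZ(1) unfolding \<C>_def by blast
        obtain N' where N': "N' \<in> \<K>" "Z' = - N'" using ZZ(2) unfolding \<C>_def by blast
        have "\<forall>N\<in>\<K>. \<forall>N'\<in>\<K>. N \<subseteq> N' \<or> N' \<subseteq> N" using chain unfolding subset_chain_def ..
        from bspec[OF bspec[OF this N(1)] N'(1)] show ?thesis unfolding N(2) N'(2) by blast
      qed
      have "meets_orbits Y (\<Inter>\<C>)"
        unfolding meets_orbits_def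
      proof
        fix y assume y: "y \<in> Y"
        define G where "G = (\<lambda>Z. {\<sigma>. \<sigma> permutes B \<and> y \<circ> \<sigma> \<in> Z})"
        have finG: "finite (G Z)" for Z
          unfolding G_def by (rule finite_subset[OF _ finite_permutations[OF finite_B]]) blast
        obtain Z\<^sub>1 where "Z\<^sub>1 \<in> \<C>" using \<C>(1) by blast
        from ex_has_least_nat[of "\<lambda>Z. Z \<in> \<C>", OF this, of "\<lambda>Z. card (G Z)"]
        obtain Z\<^sub>0 where Z\<^sub>0: "Z\<^sub>0 \<in> \<C>" "\<And>Z. Z \<in> \<C> \<Longrightarrow> card (G Z\<^sub>0) \<le> card (G Z)"
          by (elim exE conjE) simp
        have "G Z\<^sub>0 \<noteq> {}"
        proof -
          have "meets_orbits Y Z\<^sub>0" using Z\<^sub>0(1) \<C>(2) by blast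
          from this[unfolded meets_orbits_def, rule_format, OF y] show ?thesis unfolding G_def by blast
        qed
        then obtain \<sigma> where \<sigma>: "\<sigma> \<in> G Z\<^sub>0" by blast
        have "G Z\<^sub>0 \<subseteq> G Z" if "Z \<in> \<C>" for Z
        proof (cases "Z\<^sub>0 \<subseteq> Z")
          case True
          then show ?thesis unfolding G_def by blast
        next
          case False
          then have "G Z \<subseteq> G Z\<^sub>0" using total[OF that Z\<^sub>0(1)] unfolding G_def by blast
          then have "G Z = G Z\<^sub>0" by (rule card_seteq[OF finG _ Z\<^sub>0(2)[OF that]])
          then show ?thesis by blast
        qed
        then have "\<sigma> permutes B \<and> y \<circ> \<sigma> \<in> \<Inter>\<C>" using \<sigma> unfolding G_def by blast
        then show "\<exists>\<sigma>. \<sigma> permutes B \<and> y \<circ> \<sigma> \<in> \<Inter>\<C>" by (rule exI[of _ \<sigma>])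
      qed
      moreover have "closedin T (\<Inter>\<C>)" by (rule closedin_Inter[OF \<C>(1)]) (use \<C>(2) in blast)
      moreover have "\<Inter>\<C> \<subseteq> C" using \<C> by blast
      ultimately have "\<Inter>\<C> \<in> ?\<Z>" by blast
      moreover have "N \<subseteq> - \<Inter>\<C>" if "N \<in> \<K>" for N using that unfolding \<C>_def by auto
      ultimately show ?thesis by blast
    qed
  qed
  then obtain M where M: "M \<in> uminus ` ?\<Z>" and max: "\<forall>N\<in>uminus ` ?\<Z>. M \<subseteq> N \<longrightarrow> N = M" ..
  from M obtain Z where MZ: "M = - Z" and Z: "Z \<in> ?\<Z>" ..
  have "Z' = Z" if "Z' \<subseteq> Z" "closedin T Z'" "meets_orbits Y Z'" for Z'
  proof -
    have "Z' \<in> ?\<Z>" using that Z by blast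
    then have "- Z' \<in> uminus ` ?\<Z>" by (rule imageI)
    moreover have "M \<subseteq> - Z'" using that(1) unfolding MZ by blast
    ultimately have "- Z' = M" using max by blast
    then show ?thesis unfolding MZ by blast
  qed
  then show ?thesis using Z by blast
qed

text \<open>
  If \<open>Z = C \<union> D\<close> with proper closed subsets, then by minimality neither \<open>C\<close> nor \<open>D\<close> meets all orbits.  Invariants
  that separate a missed orbit from \<open>C\<close>, respectively from \<open>D\<close>, are simultaneously nonzero at some point, whose orbit then misses \<open>Z\<close>.
\<close>

lemma irreducible_if_minimal:
  fixes u :: "nat \<Rightarrow> 'a::alg_closed_field"
  assumes u: "u \<in> split_conf" and E: "E \<subseteq> A"
    and Z: "closedin split_top Z" "meets_orbits (fixing E u) Z"
    and minimal: "\<And>Z'. Z' \<subseteq> Z \<Longrightarrow> closedin split_top Z' \<Longrightarrow> meets_orbits (fixing E u) Z' \<Longrightarrow> Z' = Z"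
  shows "irreducible_space (subtopology split_top Z)"
  unfolding irreducible_space_def
proof (intro conjI allI impI)
  have top: "topspace (subtopology split_top Z) = Z"
    using closedin_subset[OF Z(1)] by (simp only: topspace_subtopology) blast
  have uY: "u \<in> fixing E u" using u unfolding fixing_def by blast
  show "topspace (subtopology split_top Z) \<noteq> {}"
    using Z(2) uY unfolding top meets_orbits_def by blast
  fix C D
  assume CD: "closedin (subtopology split_top Z) C \<and> closedin (subtopology split_top Z) D \<and>
    C \<union> D = topspace (subtopology split_top Z)"
  then have C: "closedin split_top C" and D: "closedin split_top D" and un: "C \<union> D = Z"
    using closedin_trans_full Z(1) unfolding top by blast+
  show "C = topspace (subtopology split_top Z) \<or> D = topspace (subtopology split_top Z)"
    unfolding top
  proof (rule ccontr)
    assume no: "\<not> (C = Z \<or> D = Z)"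
    then have "\<not> meets_orbits (fixing E u) C" "\<not> meets_orbits (fixing E u) D"
      using minimal[OF _ C] minimal[OF _ D] un by blast+
    then obtain y\<^sub>1 y\<^sub>2 where y\<^sub>1: "y\<^sub>1 \<in> fixing E u" "\<And>\<sigma>. \<sigma> permutes B \<Longrightarrow> y\<^sub>1 \<circ> \<sigma> \<notin> C"
      and y\<^sub>2: "y\<^sub>2 \<in> fixing E u" "\<And>\<sigma>. \<sigma> permutes B \<Longrightarrow> y\<^sub>2 \<circ> \<sigma> \<notin> D"
      unfolding meets_orbits_def by blast
    have yV: "y\<^sub>1 \<in> split_conf" "y\<^sub>2 \<in> split_conf"
      using y\<^sub>1(1) y\<^sub>2(1) unfolding fixing_def by blast+
    obtain f\<^sub>1 where f\<^sub>1: "f\<^sub>1 \<in> subalg split_conf (gens {})" "f\<^sub>1 y\<^sub>1 \<noteq> 0"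
      "\<forall>q\<in>split_conf. \<forall>\<sigma>. \<sigma> permutes B \<and> q \<circ> \<sigma> \<in> C \<longrightarrow> f\<^sub>1 q = 0"
      using separating_invariant[OF C yV(1) y\<^sub>1(2)] by blast
    obtain f\<^sub>2 where f\<^sub>2: "f\<^sub>2 \<in> subalg split_conf (gens {})" "f\<^sub>2 y\<^sub>2 \<noteq> 0"
      "\<forall>q\<in>split_conf. \<forall>\<sigma>. \<sigma> permutes B \<and> q \<circ> \<sigma> \<in> D \<longrightarrow> f\<^sub>2 q = 0"
      using separating_invariant[OF D yV(2) y\<^sub>2(2)] by blast
    obtain y where y: "y \<in> fixing E u" "f\<^sub>1 y \<noteq> 0" "f\<^sub>2 y \<noteq> 0"
      using invariants_both_nonzero[OF f\<^sub>1(1) f\<^sub>2(1) E y\<^sub>1(1) y\<^sub>2(1) f\<^sub>1(2) f\<^sub>2(2)] by blast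
    obtain \<sigma> where "\<sigma> permutes B" "y \<circ> \<sigma> \<in> Z"
      using Z(2) y(1) unfolding meets_orbits_def by blast
    then show False using f\<^sub>1(3) f\<^sub>2(3) y un unfolding fixing_def by blast
  qed
qed

lemma closedin_fixing: 
  assumes "E \<subseteq> A" shows "closedin split_top (fixing E u)"
  unfolding closedin_split_top
proof (intro exI conjI)
  show "(\<lambda>a q. q a - u a) ` E \<subseteq> poly_funs (2*d)"
  proof (rule image_subsetI)
    fix a assume "a \<in> E"
    then have "a \<in> {1..2*d}" using assms union by blast
    then show "(\<lambda>q. q a - u a) \<in> poly_funs (2*d)"
      by (intro poly_funs_diff poly_funs.coord poly_funs.const)
  qed
  show "fixing E u = {q \<in> split_conf. \<forall>f\<in>(\<lambda>a q. q a - u a) ` E. f q = 0}"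
    unfolding fixing_def by auto
qed

lemma closedin_point:
  assumes "z \<in> split_conf" shows "closedin split_top {z}"
  unfolding closedin_split_top
proof (intro exI conjI)
  show "(\<lambda>i q. q i - z i) ` {1..2*d} \<subseteq> poly_funs (2*d)"
    by (intro image_subsetI poly_funs_diff poly_funs.coord poly_funs.const)
  have "q = z" if "q \<in> split_conf" "\<forall>f\<in>(\<lambda>i q. q i - z i) ` {1..2*d}. f q = 0" for q
  proof (rule PiE_ext)
    show "q \<in> affine_space (2*d)" "z \<in> affine_space (2*d)"
      using split_confD(3) that(1) assms by blast+
    show "q i = z i" if "i \<in> {1..2*d}" for i
      using bspec[OF \<open>\<forall>f\<in>_. f q = 0\<close> imageI[OF that]] by simp
  qed
  then show "{z} = {q \<in> split_conf. \<forall>f\<in>(\<lambda>i q. q i - z i) ` {1..2*d}. f q = 0}"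
    using assms by auto
qed

lemma irreducible_point:
  assumes "z \<in> topspace T" shows "irreducible_space (subtopology T {z})"
proof -
  have top: "topspace (subtopology T {z}) = {z}" using assms by auto
  show ?thesis
    unfolding irreducible_space_def top by blast
qed

text \<open>
  The chain is built from the top: below a minimal set \<open>Z\<close> for \<open>E\<close> one finds, inside \<open>Z\<close> cut with one more
  coordinate hyperplane, a minimal set for the larger index set.  When all of \<open>A\<close> is fixed only the level varies, and a
  single point is the last member.
\<close>

lemma exists_irreducible_chain:
  fixes u :: "nat \<Rightarrow> 'a::alg_closed_field"
  assumes u: "u \<in> split_conf"
  shows "E \<subseteq> A \<Longrightarrow> card (A - E) = k \<Longrightarrow> closedin split_top C \<Longrightarrow> meets_orbits (fixing E u) C \<Longrightarrow>
    \<exists>Z. (\<forall>i\<le>Suc k. closedin split_top (Z i) \<and> irreducible_space (subtopology split_top (Z i))) \<and>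
        (\<forall>i<Suc k. Z i \<subset> Z (Suc i)) \<and> Z (Suc k) \<subseteq> C"
proof (induction k arbitrary: E C)
  case 0
  have "A - E = {}" using 0(2) by simp
  then have "E = A" using 0(1) by blast
  obtain Z\<^sub>1 where Z\<^sub>1: "Z\<^sub>1 \<subseteq> C" "closedin split_top Z\<^sub>1" "meets_orbits (fixing E u) Z\<^sub>1"
    "\<And>Z'. Z' \<subseteq> Z\<^sub>1 \<Longrightarrow> closedin split_top Z' \<Longrightarrow> meets_orbits (fixing E u) Z' \<Longrightarrow> Z' = Z\<^sub>1"
    using exists_minimal_meeting_orbits[OF 0(3,4)] by (elim exE conjE) simp
  have irr: "irreducible_space (subtopology split_top Z\<^sub>1)"
    by (rule irreducible_if_minimal[OF u 0(1) Z\<^sub>1(2-4)])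
  have "u \<in> fixing E u" using u unfolding fixing_def by blast
  then obtain z where z: "z \<in> Z\<^sub>1" using Z\<^sub>1(3) unfolding meets_orbits_def by blast
  then have zV: "z \<in> split_conf"
    using closedin_subset[OF Z\<^sub>1(2)] unfolding topspace_split_top by blast
  have "finite ({c. \<not> (\<exists>q\<in>split_conf. (\<forall>a\<in>A. q a = u a) \<and> level q = c)} \<union> {level z})"
    by (rule finite_UnI[OF exists_split_conf_over[OF split_confD(1)[OF u]]]) simp
  from ex_new_if_finite[OF infinite_UNIV_alg_closed this]
  obtain c where c: "c \<notin> {c. \<not> (\<exists>q\<in>split_conf. (\<forall>a\<in>A. q a = u a) \<and> level q = c)} \<union> {level z}" ..
  then obtain q where q: "q \<in> split_conf" "\<forall>a\<in>A. q a = u a" "level q = c" by blast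
  then have "q \<in> fixing E u" unfolding fixing_def \<open>E = A\<close> by blast
  then obtain \<sigma> where \<sigma>: "\<sigma> permutes B" "q \<circ> \<sigma> \<in> Z\<^sub>1" using Z\<^sub>1(3) unfolding meets_orbits_def by blast
  have "q \<circ> \<sigma> \<noteq> z" using level_perm[OF q(1) \<sigma>(1)] c q(3) by auto
  then have "{z} \<subset> Z\<^sub>1" using \<sigma>(2) z by blast
  moreover have "closedin split_top {z}" by (rule closedin_point[OF zV])
  moreover have "irreducible_space (subtopology split_top {z})"
    by (rule irreducible_point) (simp only: topspace_split_top zV)
  ultimately show ?case
    using Z\<^sub>1(1,2) irr by (intro exI[of _ "\<lambda>i. if i = 0 then {z} else Z\<^sub>1"]) simp
next
  case (Suc k)
  then have "A - E \<noteq> {}" by (intro notI) simp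
  then obtain a where a: "a \<in> A" "a \<notin> E" by blast
  have "A - insert a E = (A - E) - {a}" by blast
  then have card: "card (A - insert a E) = k" using a Suc.prems(2) by simp
  have E': "insert a E \<subseteq> A" using a Suc.prems(1) by blast
  obtain Z\<^sub>1 where Z\<^sub>1: "Z\<^sub>1 \<subseteq> C" "closedin split_top Z\<^sub>1" "meets_orbits (fixing E u) Z\<^sub>1"
    "\<And>Z'. Z' \<subseteq> Z\<^sub>1 \<Longrightarrow> closedin split_top Z' \<Longrightarrow> meets_orbits (fixing E u) Z' \<Longrightarrow> Z' = Z\<^sub>1"
    using exists_minimal_meeting_orbits[OF Suc.prems(3,4)] by (elim exE conjE) simp
  have irr: "irreducible_space (subtopology split_top Z\<^sub>1)"
    by (rule irreducible_if_minimal[OF u Suc.prems(1) Z\<^sub>1(2-4)])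
  have closed: "closedin split_top (Z\<^sub>1 \<inter> fixing (insert a E) u)"
    by (rule closedin_Int[OF Z\<^sub>1(2) closedin_fixing[OF E']])
  have meets: "meets_orbits (fixing (insert a E) u) (Z\<^sub>1 \<inter> fixing (insert a E) u)"
    unfolding meets_orbits_def
  proof
    fix y assume y: "y \<in> fixing (insert a E) u"
    then have "y \<in> fixing E u" unfolding fixing_def by blast
    then obtain \<sigma> where \<sigma>: "\<sigma> permutes B" "y \<circ> \<sigma> \<in> Z\<^sub>1" using Z\<^sub>1(3) unfolding meets_orbits_def by blast
    have "(y \<circ> \<sigma>) i = u i" if "i \<in> insert a E" for i
    proof -
      have "\<sigma> i = i" using perm_A[OF \<sigma>(1)] E' that by blast
      then show ?thesis using y that unfolding fixing_def by auto
    qed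
    moreover have "y \<circ> \<sigma> \<in> split_conf"
      using split_conf_perm[OF _ \<sigma>(1)] y unfolding fixing_def by blast
    ultimately have "y \<circ> \<sigma> \<in> fixing (insert a E) u" unfolding fixing_def by blast
    then show "\<exists>\<sigma>. \<sigma> permutes B \<and> y \<circ> \<sigma> \<in> Z\<^sub>1 \<inter> fixing (insert a E) u" using \<sigma> by blast
  qed
  from Suc.IH[OF E' card closed meets] obtain Z where
    "(\<forall>i\<le>Suc k. closedin split_top (Z i) \<and> irreducible_space (subtopology split_top (Z i))) \<and>
     (\<forall>i<Suc k. Z i \<subset> Z (Suc i)) \<and> Z (Suc k) \<subseteq> Z\<^sub>1 \<inter> fixing (insert a E) u" ..
  then have Z:
    "\<forall>i\<le>Suc k. closedin split_top (Z i) \<and> irreducible_space (subtopology split_top (Z i))"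
    "\<forall>i<Suc k. Z i \<subset> Z (Suc i)" "Z (Suc k) \<subseteq> Z\<^sub>1 \<inter> fixing (insert a E) u"
    by blast+
  obtain w where w: "w \<notin> u ` A"
    using ex_new_if_finite[OF infinite_UNIV_alg_closed finite_imageI[OF finite_A]] by blast
  \<comment> \<open>A configuration over \<open>u\<close> with only the coordinate \<open>a\<close> changed lies in the larger stratum but not in the smaller one.\<close>
  define x where "x = u(a := w)"
  have "inj_on x A"
    unfolding x_def using split_confD(1)[OF u] w by (rule inj_on_fun_updI)
  from ex_new_if_finite[OF infinite_UNIV_alg_closed exists_split_conf_over[OF this]]
  obtain c where "c \<notin> {c. \<not> (\<exists>q\<in>split_conf. (\<forall>i\<in>A. q i = x i) \<and> level q = c)}" ..
  then obtain q where q: "q \<in> split_conf" "\<forall>i\<in>A. q i = x i" by blast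
  have "q i = u i" if "i \<in> E" for i
  proof -
    have "i \<in> A" "i \<noteq> a" using that a Suc.prems(1) by blast+
    then show ?thesis using q(2) by (simp add: x_def)
  qed
  then have "q \<in> fixing E u" using q(1) unfolding fixing_def by blast
  then obtain \<sigma> where \<sigma>: "\<sigma> permutes B" "q \<circ> \<sigma> \<in> Z\<^sub>1" using Z\<^sub>1(3) unfolding meets_orbits_def by blast
  have "(q \<circ> \<sigma>) a = w" using perm_A[OF \<sigma>(1) a(1)] bspec[OF q(2) a(1)] by (simp add: x_def)
  then have "q \<circ> \<sigma> \<notin> fixing (insert a E) u" using w a(1) unfolding fixing_def by blast
  then have strict: "Z (Suc k) \<subset> Z\<^sub>1" using Z(3) \<sigma>(2) by blast
  define Z' where "Z' = (\<lambda>i. if i \<le> Suc k then Z i else Z\<^sub>1)"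
  have "closedin split_top (Z' i) \<and> irreducible_space (subtopology split_top (Z' i))" for i
    unfolding Z'_def using Z(1) irr Z\<^sub>1(2) by simp
  moreover have "Z' i \<subset> Z' (Suc i)" if "i < Suc (Suc k)" for i
  proof (cases "i = Suc k")
    case True
    then show ?thesis using strict by (simp add: Z'_def)
  next
    case False
    then show ?thesis using that Z(2) by (simp add: Z'_def)
  qed
  moreover have "Z' (Suc (Suc k)) \<subseteq> C" using Z\<^sub>1(1) by (simp add: Z'_def)
  ultimately show ?case by blast
qed

lemma krull_dim_split_conf_ge:
  "enat (d + 1) \<le> krull_dim (split_top :: (nat \<Rightarrow> 'a::alg_closed_field) topology)"
proof -
  obtain u :: "nat \<Rightarrow> 'a" where u: "u \<in> split_conf" using split_conf_nonempty by blast
  have "meets_orbits (fixing {} u) split_conf"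
    unfolding meets_orbits_def
  proof
    fix y assume "y \<in> fixing {} u"
    then have "y \<circ> id \<in> split_conf" unfolding fixing_def comp_id by blast
    then show "\<exists>\<sigma>. \<sigma> permutes B \<and> y \<circ> \<sigma> \<in> split_conf"
      by (intro exI[of _ id] conjI permutes_id)
  qed
  moreover have "closedin split_top (split_conf :: (nat \<Rightarrow> 'a) set)"
    using closedin_topspace[of split_top] unfolding topspace_split_top .
  ultimately have "\<exists>Z. (\<forall>i\<le>Suc d. closedin split_top (Z i) \<and> irreducible_space (subtopology split_top (Z i))) \<and>
      (\<forall>i<Suc d. Z i \<subset> Z (Suc i)) \<and> Z (Suc d) \<subseteq> (split_conf :: (nat \<Rightarrow> 'a) set)"
    by (intro exists_irreducible_chain[OF u, of "{}"]) (simp_all only: Diff_empty card_A empty_subsetI)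
  then obtain Z where Z: "(\<forall>i\<le>Suc d. closedin split_top (Z i) \<and> irreducible_space (subtopology split_top (Z i))) \<and>
      (\<forall>i<Suc d. Z i \<subset> Z (Suc i)) \<and> Z (Suc d) \<subseteq> (split_conf :: (nat \<Rightarrow> 'a) set)" ..
  have "(\<forall>i\<le>Suc d. closedin split_top (Z i) \<and> irreducible_space (subtopology split_top (Z i))) \<and>
      (\<forall>i<Suc d. Z i \<subset> Z (Suc i))" by (rule conjI[OF conjunct1[OF Z] conjunct1[OF conjunct2[OF Z]]])
  then show ?thesis
    unfolding krull_dim_def Suc_eq_plus1[symmetric]
    by (intro Sup_upper CollectI exI[of _ "Suc d"] conjI[OF refl] exI[of _ Z])
qed

end

section \<open>Counting independent functions of bounded degree\<close>

text \<open>
  Gaussian elimination: fewer homogeneous equations than unknowns have a nontrivial solution.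
\<close>

lemma exists_nontrivial_relation:
  fixes M :: "'i \<Rightarrow> 'k \<Rightarrow> 'a::field"
  assumes "finite K" "finite I" "card K < card I"
  shows "\<exists>c. (\<exists>i\<in>I. c i \<noteq> 0) \<and> (\<forall>k\<in>K. (\<Sum>i\<in>I. c i * M i k) = 0)"
  using assms
proof (induction K arbitrary: I M rule: finite_induct)
  case empty
  then obtain i where "i \<in> I" by fastforce
  then show ?case by (intro exI[of _ "\<lambda>_. 1"]) auto
next
  case (insert k K)
  show ?case
  proof (cases "\<forall>i\<in>I. M i k = 0")
    case True
    have "card K < card I" using insert.prems(2) insert.hyps by simp
    from insert.IH[OF insert.prems(1) this, of M]
    obtain c where "\<exists>i\<in>I. c i \<noteq> 0" "\<forall>k\<in>K. (\<Sum>i\<in>I. c i * M i k) = 0" by blast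
    then show ?thesis using True by (intro exI[of _ c]) simp
  next
    case False
    then obtain p where p: "p \<in> I" "M p k \<noteq> 0" by blast
    define I' where "I' = I - {p}"
    have I': "finite I'" "p \<notin> I'" "I = insert p I'" using p insert.prems by (auto simp: I'_def)
    have "card K < card I'" using insert.prems insert.hyps I' by simp
    then obtain c where c: "\<exists>i\<in>I'. c i \<noteq> 0"
      "\<forall>l\<in>K. (\<Sum>i\<in>I'. c i * (M i l - M i k / M p k * M p l)) = 0"
      using insert.IH[OF I'(1) \<open>card K < card I'\<close>, of "\<lambda>i l. M i l - M i k / M p k * M p l"] by blast
    \<comment> \<open>Solve the eliminated equation for the unknown of the pivot \<open>p\<close>.\<close>
  define e where "e = c(p := - (\<Sum>i\<in>I'. c i * (M i k / M p k)))"
    have sum: "(\<Sum>i\<in>I. e i * M i l) = (\<Sum>i\<in>I'. c i * (M i l - M i k / M p k * M p l))" for l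
    proof -
      have "(\<Sum>i\<in>I'. e i * M i l) = (\<Sum>i\<in>I'. c i * M i l)"
        using I'(2) by (intro sum.cong) (auto simp: e_def)
      then have "(\<Sum>i\<in>I. e i * M i l) = - (\<Sum>i\<in>I'. c i * (M i k / M p k)) * M p l + (\<Sum>i\<in>I'. c i * M i l)"
        unfolding I'(3) using I'(1,2) by (simp add: e_def)
      then show ?thesis
        by (simp add: right_diff_distrib sum_subtractf sum_distrib_right mult.assoc)
    qed
    have "(\<Sum>i\<in>I. e i * M i l) = 0" if "l \<in> insert k K" for l
      using that c(2) p(2) unfolding sum by auto
    moreover have "\<exists>i\<in>I. e i \<noteq> 0"
    proof -
      obtain i where i: "i \<in> I'" "c i \<noteq> 0" using c(1) by blast
      then have "i \<noteq> p" using I'(2) by blast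
      then show ?thesis using i I'(3) by (intro bexI[of _ i]) (simp_all add: e_def)
    qed
    ultimately show ?thesis by blast
  qed
qed

text \<open>
  Degree at most \<open>N\<close>, as a property of a way to write the function; the same function may arise in several ways.
\<close>

inductive poly_fun_deg :: "nat \<Rightarrow> nat \<Rightarrow> ((nat \<Rightarrow> 'a::field) \<Rightarrow> 'a) \<Rightarrow> bool" for n where
  const: "poly_fun_deg n N (\<lambda>x. c)"
| coord_mult: "i \<in> {1..n} \<Longrightarrow> poly_fun_deg n N f \<Longrightarrow> poly_fun_deg n (Suc N) (\<lambda>x. x i * f x)"
| add: "poly_fun_deg n N f \<Longrightarrow> poly_fun_deg n N g \<Longrightarrow> poly_fun_deg n N (\<lambda>x. f x + g x)"

lemma poly_fun_deg_mono: "poly_fun_deg n N f \<Longrightarrow> N \<le> M \<Longrightarrow> poly_fun_deg n M f"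
proof (induction arbitrary: M rule: poly_fun_deg.induct)
  case (coord_mult i N f)
  obtain M' where M: "M = Suc M'" "N \<le> M'" using coord_mult.prems by (cases M) simp_all
  show ?case unfolding M(1) by (rule poly_fun_deg.coord_mult[OF coord_mult.hyps(1) coord_mult.IH[OF M(2)]])
next
  case (add N f g)
  show ?case by (rule poly_fun_deg.add[OF add.IH[OF add.prems]])
qed (rule poly_fun_deg.const)

lemma poly_fun_deg_scale: "poly_fun_deg n N f \<Longrightarrow> poly_fun_deg n N (\<lambda>x. c * f x)"
proof (induction rule: poly_fun_deg.induct)
  case (coord_mult i N f)
  then show ?case using poly_fun_deg.coord_mult[OF coord_mult(1,3)] by (simp add: mult.left_commute)
next
  case (add N f g)
  then show ?case using poly_fun_deg.add[OF add(3,4)] by (simp add: distrib_left)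
qed (rule poly_fun_deg.const)

lemma poly_fun_deg_mult:
  assumes "poly_fun_deg n N f" "poly_fun_deg n M g"
  shows "poly_fun_deg n (N + M) (\<lambda>x. f x * g x)"
  using assms(1)
proof (induction rule: poly_fun_deg.induct)
  case (const N c)
  show ?case by (rule poly_fun_deg_mono[OF poly_fun_deg_scale[OF assms(2)]]) simp
next
  case (coord_mult i N f)
  then show ?case using poly_fun_deg.coord_mult[OF coord_mult(1,3)] by (simp add: mult.assoc)
next
  case (add N f g)
  then show ?case using poly_fun_deg.add[OF add(3,4)] by (simp add: distrib_right)
qed

lemma poly_funs_if_deg: "poly_fun_deg n N f \<Longrightarrow> f \<in> poly_funs n"
proof (induction rule: poly_fun_deg.induct)
  case (coord_mult i N f)
  show ?case by (rule poly_funs.mult[OF poly_funs.coord]) fact+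
qed (rule poly_funs.const, rule poly_funs.add)

lemma poly_funs_has_deg:
  assumes "f \<in> poly_funs n" shows "\<exists>N. poly_fun_deg n N f"
  using assms
proof induction
  case (coord i)
  then show ?case using poly_fun_deg.coord_mult[OF coord poly_fun_deg.const[of n 0 1]] by auto
next
  case (add f g)
  then obtain N M where "poly_fun_deg n N f" "poly_fun_deg n M g" by blast
  then have "poly_fun_deg n (max N M) f" "poly_fun_deg n (max N M) g"
    by (simp_all add: poly_fun_deg_mono)
  then show ?case using poly_fun_deg.add by blast
next
  case (mult f g)
  then show ?case using poly_fun_deg_mult by blast
qed (use poly_fun_deg.const in blast)

definition independent_on :: "'x set \<Rightarrow> nat \<Rightarrow> (nat \<Rightarrow> 'x \<Rightarrow> 'a::field) \<Rightarrow> bool" where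
  "independent_on Z m f \<longleftrightarrow> (\<forall>c. (\<forall>x\<in>Z. (\<Sum>i<m. c i * f i x) = 0) \<longrightarrow> (\<forall>i<m. c i = 0))"

text \<open>
  A lower bound \<open>m\<close> for the Hilbert function of \<open>Z\<close> at \<open>N\<close>.  Stating the bound instead of the value avoids all dimension theory
  of vector spaces of functions.
\<close>

definition independent_of_deg :: "nat \<Rightarrow> (nat \<Rightarrow> 'a::field) set \<Rightarrow> nat \<Rightarrow> nat \<Rightarrow> bool" where
  "independent_of_deg n Z N m \<longleftrightarrow> (\<exists>f. (\<forall>i<m. poly_fun_deg n N (f i)) \<and> independent_on Z m f)"

lemma independent_of_deg_one:
  fixes Z :: "(nat \<Rightarrow> 'a::field) set"
  assumes "Z \<noteq> {}" shows "independent_of_deg n Z N 1"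
proof -
  obtain z where "z \<in> Z" using assms by blast
  then have "independent_on Z 1 (\<lambda>i x. 1 :: 'a)"
    unfolding independent_on_def by fastforce
  then show ?thesis
    unfolding independent_of_deg_def using poly_fun_deg.const by (intro exI[of _ "\<lambda>i x. 1"]) simp
qed

lemma sum_lessThan_plus: "(\<Sum>i<m + k. F i) = (\<Sum>i<m. F i) + (\<Sum>j<k. F (m + j))"
  for F :: "nat \<Rightarrow> 'a::comm_monoid_add"
  by (induction k) (simp_all add: add.assoc)

text \<open>
  Combine lifts \<open>f\<^sub>i\<close> of independent functions on \<open>Z\<close> with the multiples \<open>g h\<^sub>j\<close> of independent functions on \<open>Z'\<close>.  Restricting a
  relation to \<open>Z\<close> kills the \<open>g h\<^sub>j\<close> and hence the coefficients of the \<open>f\<^sub>i\<close>; as \<open>Z'\<close> is irreducible, \<open>g\<close> can then be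
  cancelled from what is left.
\<close>

lemma independent_of_deg_extend:
  assumes sub: "Z \<subseteq> Z'"
    and prime: "\<And>f g. f \<in> poly_funs n \<Longrightarrow> g \<in> poly_funs n \<Longrightarrow> (\<forall>x\<in>Z'. f x * g x = 0) \<Longrightarrow>
      (\<forall>x\<in>Z'. f x = 0) \<or> (\<forall>x\<in>Z'. g x = 0)"
    and g: "poly_fun_deg n a g" "\<forall>x\<in>Z. g x = 0" "\<not> (\<forall>x\<in>Z'. g x = 0)"
    and Z: "independent_of_deg n Z N m" and Z': "independent_of_deg n Z' M k"
    and "N \<le> K" "M + a \<le> K"
  shows "independent_of_deg n Z' K (m + k)"
proof -
  obtain f where f: "\<forall>i<m. poly_fun_deg n N (f i)" "independent_on Z m f"
    using Z unfolding independent_of_deg_def by blast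
  obtain h where h: "\<forall>i<k. poly_fun_deg n M (h i)" "independent_on Z' k h"
    using Z' unfolding independent_of_deg_def by blast
  define F where "F = (\<lambda>i. if i < m then f i else (\<lambda>x. g x * h (i - m) x))"
  have "poly_fun_deg n K (F i)" if "i < m + k" for i
  proof (cases "i < m")
    case True
    then have "poly_fun_deg n N (f i)" using f(1) by blast
    from poly_fun_deg_mono[OF this assms(8)] show ?thesis using True by (simp add: F_def)
  next
    case False
    then have "poly_fun_deg n M (h (i - m))" using h(1) that by simp
    from poly_fun_deg_mult[OF g(1) this] have "poly_fun_deg n K (\<lambda>x. g x * h (i - m) x)"
      by (rule poly_fun_deg_mono) (use assms(9) in simp)
    then show ?thesis using False by (simp add: F_def)
  qed
  moreover have "independent_on Z' (m + k) F"
    unfolding independent_on_def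
  proof (intro allI impI)
    fix c i assume c: "\<forall>x\<in>Z'. (\<Sum>i<m + k. c i * F i x) = 0" and i: "i < m + k"
    have split: "(\<Sum>i<m + k. c i * F i x) = (\<Sum>i<m. c i * f i x) + g x * (\<Sum>j<k. c (m + j) * h j x)" for x
    proof -
      have "(\<Sum>i<m. c i * F i x) = (\<Sum>i<m. c i * f i x)"
        by (intro sum.cong) (simp_all add: F_def)
      moreover have "(\<Sum>j<k. c (m + j) * F (m + j) x) = g x * (\<Sum>j<k. c (m + j) * h j x)"
        by (simp add: F_def sum_distrib_left mult.left_commute)
      ultimately show ?thesis unfolding sum_lessThan_plus by simp
    qed
    have "\<forall>x\<in>Z. (\<Sum>i<m. c i * f i x) = 0"
    proof
      fix x assume x: "x \<in> Z"
      then have "(\<Sum>i<m + k. c i * F i x) = 0" using c sub by blast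
      then show "(\<Sum>i<m. c i * f i x) = 0" unfolding split using g(2) x by simp
    qed
    then have c0: "\<forall>i<m. c i = 0" using f(2) unfolding independent_on_def by blast
    define s where "s = (\<lambda>x. \<Sum>j<k. c (m + j) * h j x)"
    have "\<forall>x\<in>Z'. g x * s x = 0"
    proof
      fix x assume "x \<in> Z'"
      then have "(\<Sum>i<m + k. c i * F i x) = 0" using c by blast
      moreover have "(\<Sum>i<m. c i * f i x) = 0" using c0 by simp
      ultimately show "g x * s x = 0" unfolding split s_def by simp
    qed
    moreover have "s \<in> poly_funs n"
      unfolding s_def
    proof (rule poly_funs_sum)
      fix j assume "j \<in> {..<k}"
      then have "poly_fun_deg n M (h j)" using h(1) by blast
      then show "(\<lambda>x. c (m + j) * h j x) \<in> poly_funs n"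
        by (intro poly_funs_if_deg poly_fun_deg_scale)
    qed
    moreover have "g \<in> poly_funs n" using g(1) by (rule poly_funs_if_deg)
    ultimately have "\<forall>x\<in>Z'. s x = 0" using prime g(3) by blast
    then have c1: "\<forall>j<k. c (m + j) = 0"
      using h(2)[unfolded independent_on_def, THEN spec, of "\<lambda>j. c (m + j)"] unfolding s_def by blast
    show "c i = 0"
    proof (cases "i < m")
      case False
      then obtain j where "i = m + j" by (metis le_add_diff_inverse not_less)
      then show ?thesis using c1 i by simp
    qed (use c0 in blast)
  qed
  ultimately show ?thesis unfolding independent_of_deg_def by blast
qed

lemma irreducible_imp_prime:
  assumes irr: "irreducible_space (subtopology (subtopology (zariski n) V) Z)"
    and Z: "Z \<subseteq> V" "Z \<subseteq> affine_space n" and fg: "f \<in> poly_funs n" "g \<in> poly_funs n"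
    and zero: "\<forall>x\<in>Z. f x * g x = 0"
  shows "(\<forall>x\<in>Z. f x = 0) \<or> (\<forall>x\<in>Z. g x = 0)"
proof -
  let ?T = "subtopology (zariski n) Z"
  have T: "subtopology (subtopology (zariski n) V) Z = ?T"
    using Z(1) by (simp add: subtopology_subtopology inf.absorb2)
  have top: "topspace ?T = Z" using Z(2) by (simp add: inf.absorb2)
  have closed: "closedin ?T {x \<in> Z. h x = 0}" if "h \<in> poly_funs n" for h
  proof -
    have "closedin (zariski n) (zero_locus n {h})"
      unfolding closedin_zariski using that by blast
    moreover have "{x \<in> Z. h x = 0} = zero_locus n {h} \<inter> Z"
      using Z(2) unfolding zero_locus_def by blast
    ultimately show ?thesis unfolding closedin_subtopology by blast
  qed
  have "{x \<in> Z. f x = 0} \<union> {x \<in> Z. g x = 0} = Z" using zero by auto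
  then have "{x \<in> Z. f x = 0} = Z \<or> {x \<in> Z. g x = 0} = Z"
    using irr closed[OF fg(1)] closed[OF fg(2)] unfolding T irreducible_space_def top by blast
  then show ?thesis by blast
qed

lemma closedin_strict_separate:
  assumes "V \<subseteq> affine_space n" "closedin (subtopology (zariski n) V) Z" "Z \<subset> Z'" "Z' \<subseteq> V"
  shows "\<exists>g\<in>poly_funs n. (\<forall>x\<in>Z. g x = 0) \<and> \<not> (\<forall>x\<in>Z'. g x = 0)"
proof -
  obtain F where F: "F \<subseteq> poly_funs n" "Z = zero_locus n F \<inter> V"
    using assms(2) unfolding closedin_subtopology closedin_zariski by blast
  obtain x where x: "x \<in> Z'" "x \<notin> Z" using assms(3) by blast
  then obtain g where "g \<in> F" "g x \<noteq> 0"
    using assms(1,4) F(2) unfolding zero_locus_def by blast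
  then show ?thesis using F x(1) unfolding zero_locus_def by blast
qed

text \<open>
  By \<open>independent_of_deg_extend\<close> the counts at step \<open>i + 1\<close> dominate the partial sums of the counts at step \<open>i\<close>, and
  \<open>N \<mapsto> (N + i choose i)\<close> are the iterated partial sums of the constant \<open>1\<close>.
\<close>

lemma chain_growth:
  fixes Z :: "nat \<Rightarrow> (nat \<Rightarrow> 'a::field) set"
  assumes V: "V \<subseteq> affine_space n"
    and closed: "\<And>i. i \<le> m \<Longrightarrow> closedin (subtopology (zariski n) V) (Z i)"
    and irr: "\<And>i. i \<le> m \<Longrightarrow> irreducible_space (subtopology (subtopology (zariski n) V) (Z i))"
    and strict: "\<And>i. i < m \<Longrightarrow> Z i \<subset> Z (Suc i)"
  shows "i \<le> m \<Longrightarrow> \<exists>s\<ge>1. \<forall>N. independent_of_deg n (Z i) (s * N) ((N + i) choose i)"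
proof (induction i)
  have sub: "Z i \<subseteq> V" if "i \<le> m" for i
    using closedin_subset[OF closed[OF that]] by simp
  have nonempty: "Z i \<noteq> {}" if "i \<le> m" for i
    using irr[OF that] unfolding irreducible_space_def topspace_subtopology by blast
  {
    case 0
    then show ?case
      using independent_of_deg_one[OF nonempty[OF 0]] by (intro exI[of _ 1]) simp
  next
    case (Suc i)
    note le = Suc.prems
    have i: "i < m" using le by simp
    obtain s where s: "s \<ge> 1" "\<And>N. independent_of_deg n (Z i) (s * N) ((N + i) choose i)"
      using Suc.IH[OF less_imp_le[OF i]] by blast
    obtain g where g: "g \<in> poly_funs n" "\<forall>x\<in>Z i. g x = 0" "\<not> (\<forall>x\<in>Z (Suc i). g x = 0)"
      using closedin_strict_separate[OF V closed[OF less_imp_le[OF i]] strict[OF i] sub[OF le]] by blast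
    obtain a where a: "poly_fun_deg n a g" using poly_funs_has_deg[OF g(1)] by blast
    \<comment> \<open>With \<open>s + a\<close> in place of \<open>s\<close>, raising \<open>N\<close> by one leaves room for the degree \<open>a\<close> of \<open>g\<close>.\<close>
    have "independent_of_deg n (Z (Suc i)) ((s + a) * N) ((N + Suc i) choose (Suc i))" for N
    proof (induction N)
      case 0
      show ?case using independent_of_deg_one[OF nonempty[OF le]] by simp
    next
      case (Suc N)
      have "independent_of_deg n (Z (Suc i)) ((s + a) * Suc N)
          (((Suc N + i) choose i) + ((N + Suc i) choose (Suc i)))"
      proof (rule independent_of_deg_extend[OF _ _ a g(2,3) s(2) Suc])
        show "Z i \<subseteq> Z (Suc i)" using strict[OF i] by blast
        show "(\<forall>x\<in>Z (Suc i). f x = 0) \<or> (\<forall>x\<in>Z (Suc i). h x = 0)"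
          if "f \<in> poly_funs n" "h \<in> poly_funs n" "\<forall>x\<in>Z (Suc i). f x * h x = 0" for f h
          by (rule irreducible_imp_prime[OF irr[OF le] sub[OF le] subset_trans[OF sub[OF le] V] that])
      qed (use s(1) in \<open>simp_all add: algebra_simps\<close>)
      then show ?case by (simp add: add.commute)
    qed
    then show ?case using s(1) by (intro exI[of _ "s + a"]) simp
  }
qed

lemma independent_of_deg_le_card:
  assumes K: "finite K"
    and span: "\<And>f. poly_fun_deg n N f \<Longrightarrow> \<exists>c. \<forall>x\<in>Z. f x = (\<Sum>k\<in>K. c k * b k x)"
    and ind: "independent_of_deg n Z N m"
  shows "m \<le> card K"
proof (rule ccontr)
  assume "\<not> m \<le> card K"
  then have less: "card K < card {..<m}" by simp
  obtain f where f: "\<forall>i<m. poly_fun_deg n N (f i)" "independent_on Z m f"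
    using ind unfolding independent_of_deg_def by blast
  have "\<forall>i\<in>{..<m}. \<exists>c. \<forall>x\<in>Z. f i x = (\<Sum>k\<in>K. c k * b k x)"
    using f(1) by (intro ballI span) simp
  from bchoice[OF this] obtain M where "\<forall>i\<in>{..<m}. \<forall>x\<in>Z. f i x = (\<Sum>k\<in>K. M i k * b k x)" ..
  then have M: "f i x = (\<Sum>k\<in>K. M i k * b k x)" if "i < m" "x \<in> Z" for i x
    using that by blast
  obtain c where c: "\<exists>i\<in>{..<m}. c i \<noteq> 0" "\<forall>k\<in>K. (\<Sum>i<m. c i * M i k) = 0"
    using exists_nontrivial_relation[OF K finite_lessThan less, of M] by blast
  have "(\<Sum>i<m. c i * f i x) = 0" if "x \<in> Z" for x
  proof -
    have "(\<Sum>i<m. c i * f i x) = (\<Sum>i<m. \<Sum>k\<in>K. c i * M i k * b k x)"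
      using M[OF _ that] by (intro sum.cong refl) (simp add: sum_distrib_left mult.assoc)
    also have "\<dots> = (\<Sum>k\<in>K. (\<Sum>i<m. c i * M i k) * b k x)"
      by (subst sum.swap) (simp add: sum_distrib_right)
    also have "\<dots> = 0" using c(2) by simp
    finally show ?thesis .
  qed
  then show False using f(2) c(1) unfolding independent_on_def by blast
qed

text \<open>
  \<open>(N + m choose m)\<close> grows like \<open>N\<^sup>m\<close>, which exceeds \<open>C (s N + 1)\<^sup>D\<close> for large \<open>N\<close> if \<open>m > D\<close>.
\<close>

lemma binomial_growth:
  fixes m D s C :: nat
  assumes bound: "\<And>N. (N + m) choose m \<le> C * (s * N + 1) ^ D" and "s \<ge> 1"
  shows "m \<le> D"
proof (rule ccontr)
  assume "\<not> m \<le> D"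
  then have D: "D < m" by simp
  define c where "c = m ^ m * (C * s ^ D)"
  \<comment> \<open>For \<open>N = c + 1\<close> the bound would give \<open>y\<^bsup>m-D\<^esup> \<le> c\<close>, although \<open>y > c\<close>.\<close>
  define y where "y = Suc c + m"
  have "(real y / real m) ^ m \<le> real (y choose m)"
    by (rule binomial_ge_n_over_k_pow_k) (simp add: y_def)
  then have "real y ^ m \<le> real m ^ m * real (y choose m)"
    using D by (simp add: power_divide pos_divide_le_eq mult.commute)
  also have "\<dots> = real (m ^ m * (y choose m))" by simp
  finally have "y ^ m \<le> m ^ m * (y choose m)" by (metis of_nat_le_iff of_nat_power)
  also have "y choose m \<le> C * (s * Suc c + 1) ^ D" unfolding y_def by (rule bound)
  also have "s * Suc c + 1 \<le> s * y"
  proof -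
    have "1 * 1 \<le> s * m" using assms(2) D by (intro mult_le_mono) simp_all
    then show ?thesis by (simp add: y_def add_mult_distrib2)
  qed
  finally have "y ^ m \<le> m ^ m * (C * (s * y) ^ D)"
    by (simp add: power_mono mult_le_mono)
  also have "\<dots> = c * y ^ D" by (simp add: c_def power_mult_distrib mult_ac)
  finally have "y ^ (m - D) * y ^ D \<le> c * y ^ D"
    using D by (simp flip: power_add)
  then have "y ^ (m - D) \<le> c" by (simp add: y_def)
  moreover have "y \<le> y ^ (m - D)" using D by (intro self_le_power) (auto simp: y_def)
  ultimately show False by (simp add: y_def)
qed

context split_indices
begin

section \<open>Normal forms and the upper bound\<close>

text \<open>
  Exponents of the coordinates, together with an exponent of the level.  Only the \<open>d\<close> coordinates indexed by \<open>A\<close> and the level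
  have exponents that grow with \<open>N\<close>; this is where the dimension \<open>d + 1\<close> shows.
\<close>

definition normal_exponents :: "nat \<Rightarrow> ((nat \<Rightarrow> nat) \<times> nat) set" where
  "normal_exponents N = (\<Pi>\<^sub>E i\<in>{1..2*d}. if i \<in> A then {..N} else {..<d}) \<times> {..N}"

definition level_monom :: "(nat \<Rightarrow> nat) \<times> nat \<Rightarrow> (nat \<Rightarrow> 'a::field) \<Rightarrow> 'a" where
  "level_monom = (\<lambda>(\<nu>, \<gamma>) x. (\<Prod>i\<in>{1..2*d}. x i ^ \<nu> i) * level x ^ \<gamma>)"

definition normal_span :: "nat \<Rightarrow> ((nat \<Rightarrow> 'a::field) \<Rightarrow> 'a) set" where
  "normal_span N = {f. \<exists>c. \<forall>x\<in>split_conf. f x = (\<Sum>k\<in>normal_exponents N. c k * level_monom k x)}"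

lemma finite_normal_exponents: "finite (normal_exponents N)"
  unfolding normal_exponents_def by (intro finite_cartesian_product finite_PiE) simp_all

lemma card_normal_exponents: "card (normal_exponents N) = d ^ d * (N + 1) ^ (d + 1)"
proof -
  have "(\<Prod>i\<in>{1..2*d}. card (if i \<in> A then {..N} else {..<d})) =
      (\<Prod>i\<in>A. card (if i \<in> A then {..N} else {..<d})) * (\<Prod>i\<in>B. card (if i \<in> A then {..N} else {..<d}))"
    unfolding union[symmetric] by (rule prod.union_disjoint) (simp_all add: disjoint)
  also have "(\<Prod>i\<in>A. card (if i \<in> A then {..N} else {..<d})) = (N + 1) ^ d"
    by (simp add: card_A)
  also have "(\<Prod>i\<in>B. card (if i \<in> A then {..N} else {..<d})) = (\<Prod>i\<in>B. d)"
    by (rule prod.cong) (use disjoint in auto)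
  finally show ?thesis
    by (simp add: normal_exponents_def card_cartesian_product card_PiE card_B algebra_simps)
qed

lemma normal_spanI:
  assumes "\<And>x. x \<in> split_conf \<Longrightarrow> f x = (\<Sum>k\<in>normal_exponents N. c k * level_monom k x)"
  shows "f \<in> normal_span N"
  unfolding normal_span_def by (rule CollectI, rule exI[of _ c]) (use assms in simp)

lemma normal_span_add:
  assumes "f \<in> normal_span N" "g \<in> normal_span N"
  shows "(\<lambda>x. f x + g x) \<in> normal_span N"
proof -
  obtain c where c: "\<forall>x\<in>split_conf. f x = (\<Sum>k\<in>normal_exponents N. c k * level_monom k x)"
    using assms(1) unfolding normal_span_def by blast
  obtain e where e: "\<forall>x\<in>split_conf. g x = (\<Sum>k\<in>normal_exponents N. e k * level_monom k x)"
    using assms(2) unfolding normal_span_def by blast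
  show ?thesis
    by (rule normal_spanI[where c = "\<lambda>k. c k + e k"]) (simp add: c e distrib_right sum.distrib)
qed

lemma normal_span_scale:
  assumes "f \<in> normal_span N"
  shows "(\<lambda>x. a * f x) \<in> normal_span N"
proof -
  obtain c where c: "\<forall>x\<in>split_conf. f x = (\<Sum>k\<in>normal_exponents N. c k * level_monom k x)"
    using assms(1) unfolding normal_span_def by blast
  show ?thesis
    by (rule normal_spanI[where c = "\<lambda>k. a * c k"]) (simp add: c sum_distrib_left mult.assoc)
qed

lemma normal_span_zero: "(\<lambda>x. 0) \<in> normal_span N"
  by (rule normal_spanI[where c = "\<lambda>_. 0"]) simp

lemma normal_span_sum:
  assumes "\<And>i. i \<in> I \<Longrightarrow> f i \<in> normal_span N"
  shows "(\<lambda>x. \<Sum>i\<in>I. f i x) \<in> normal_span N"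
  using assms
  by (induction I rule: infinite_finite_induct) (simp_all add: normal_span_zero normal_span_add)

lemma normal_span_cong:
  assumes "f \<in> normal_span N" "\<And>x. x \<in> split_conf \<Longrightarrow> g x = f x"
  shows "g \<in> normal_span N"
  using assms unfolding normal_span_def by simp

lemma level_monom_in_normal_span:
  assumes "\<And>i. i \<in> A \<Longrightarrow> \<nu> i \<le> N" "\<And>i. i \<in> B \<Longrightarrow> \<nu> i < d" "\<gamma> \<le> N"
  shows "level_monom (\<nu>, \<gamma>) \<in> normal_span N"
proof -
  define k where "k = (restrict \<nu> {1..2*d}, \<gamma>)"
  have "restrict \<nu> {1..2*d} \<in> (\<Pi>\<^sub>E i\<in>{1..2*d}. if i \<in> A then {..N} else {..<d})"
  proof (rule restrict_PiE_iff[THEN iffD2], rule ballI)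
    fix i assume "i \<in> {1..2*d}"
    then have "i \<in> A \<or> i \<in> B" using union by blast
    moreover have "i \<notin> A" if "i \<in> B" using that disjoint by blast
    ultimately show "\<nu> i \<in> (if i \<in> A then {..N} else {..<d})"
      using assms(1,2)[of i] by (cases "i \<in> A") simp_all
  qed
  then have k: "k \<in> normal_exponents N"
    unfolding k_def normal_exponents_def using assms(3) by blast
  have eq: "level_monom (\<nu>, \<gamma>) x = level_monom k x" for x :: "nat \<Rightarrow> 'a"
    unfolding level_monom_def k_def by simp
  have "level_monom (\<nu>, \<gamma>) x = (\<Sum>l\<in>normal_exponents N. (if l = k then 1 else 0) * level_monom l x)"
    for x :: "nat \<Rightarrow> 'a"
  proof -
    have "(\<Sum>l\<in>normal_exponents N. (if l = k then 1 else 0) * level_monom l x) =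
        (\<Sum>l\<in>normal_exponents N. if l = k then level_monom l x else 0)"
      by (rule sum.cong) simp_all
    also have "\<dots> = level_monom k x" using k finite_normal_exponents by (simp add: sum.delta)
    finally show ?thesis unfolding eq by (rule sym)
  qed
  then show ?thesis by (rule normal_spanI)
qed

lemma level_monom_upd:
  assumes "i \<in> {1..2*d}"
  shows "level_monom (\<nu>(i := e), \<gamma>) x = x i ^ e * ((\<Prod>j\<in>{1..2*d} - {i}. x j ^ \<nu> j) * level x ^ \<gamma>)"
proof -
  have "(\<Prod>j\<in>{1..2*d}. x j ^ (\<nu>(i := e)) j) = x i ^ e * (\<Prod>j\<in>{1..2*d} - {i}. x j ^ (\<nu>(i := e)) j)"
    using assms by (subst prod.remove[of _ i]) simp_all
  also have "(\<Prod>j\<in>{1..2*d} - {i}. x j ^ (\<nu>(i := e)) j) = (\<Prod>j\<in>{1..2*d} - {i}. x j ^ \<nu> j)"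
    by (rule prod.cong) simp_all
  finally show ?thesis unfolding level_monom_def by (simp add: mult.assoc)
qed

text \<open>
  The equation \<open>g\<^sub>A(x\<^sub>i) = c\<close>, expanded and solved for \<open>x\<^sub>i\<^sup>d\<close>.
\<close>

lemma power_d_reduce:
  assumes "x \<in> split_conf" "i \<in> B"
  shows "x i ^ d = level x - (\<Sum>S\<in>Pow A - {{}}. (\<Prod>a\<in>S. - x a) * x i ^ (d - card S))"
proof -
  have "level x = (\<Prod>a\<in>A. - x a + x i)" using level_eq[OF assms] by simp
  also have "\<dots> = (\<Sum>S\<in>Pow A. (\<Prod>a\<in>S. - x a) * (\<Prod>a\<in>A - S. x i))"
    by (rule prod_add[OF finite_A])
  also have "\<dots> = (\<Sum>S\<in>Pow A. (\<Prod>a\<in>S. - x a) * x i ^ (d - card S))"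
  proof (rule sum.cong[OF refl])
    fix S assume "S \<in> Pow A"
    then have "card (A - S) = d - card S"
      using finite_subset[OF _ finite_A] card_A by (simp add: card_Diff_subset)
    then show "(\<Prod>a\<in>S. - x a) * (\<Prod>a\<in>A - S. x i) = (\<Prod>a\<in>S. - x a) * x i ^ (d - card S)"
      by simp
  qed
  also have "\<dots> = x i ^ d + (\<Sum>S\<in>Pow A - {{}}. (\<Prod>a\<in>S. - x a) * x i ^ (d - card S))"
    by (subst sum.remove[of _ "{}"]) simp_all
  finally show ?thesis by simp
qed

text \<open>
  Only the product with \<open>x\<^sub>i\<close>, \<open>i \<in> B\<close>, at the maximal exponent \<open>d - 1\<close> needs an argument.  In the expansion of \<open>x\<^sub>i\<^sup>d\<close> every
  coordinate of \<open>A\<close> and the level occur at most to the first power, so each exponent rises by at most one, which \<open>Suc N\<close> permits.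
\<close>

lemma level_monom_coord_mult:
  assumes k: "(\<nu>, \<gamma>) \<in> normal_exponents N" and i: "i \<in> {1..2*d}"
  shows "(\<lambda>x :: nat \<Rightarrow> 'a::field. x i * level_monom (\<nu>, \<gamma>) x) \<in> normal_span (Suc N)"
proof -
  have \<gamma>: "\<gamma> \<le> N" and \<nu>: "\<nu> \<in> (\<Pi>\<^sub>E i\<in>{1..2*d}. if i \<in> A then {..N} else {..<d})"
    using k unfolding normal_exponents_def by blast+
  have \<nu>A: "\<nu> j \<le> N" if "j \<in> A" for j
  proof -
    have "j \<in> {1..2*d}" using that union by blast
    then show ?thesis using PiE_mem[OF \<nu>, of j] that by simp
  qed
  have \<nu>B: "\<nu> j < d" if "j \<in> B" for j
  proof -
    have "j \<in> {1..2*d}" "j \<notin> A" using that union disjoint by blast+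
    then show ?thesis using PiE_mem[OF \<nu>, of j] by simp
  qed
  define R where "R = (\<lambda>x :: nat \<Rightarrow> 'a. (\<Prod>j\<in>{1..2*d} - {i}. x j ^ \<nu> j) * level x ^ \<gamma>)"
  have upd: "level_monom (\<nu>(i := e), \<gamma>) x = x i ^ e * R x" for e x
    unfolding R_def by (rule level_monom_upd[OF i])
  have eq: "x i * level_monom (\<nu>, \<gamma>) x = x i ^ Suc (\<nu> i) * R x" for x
    using upd[of "\<nu> i" x] by (simp add: mult.assoc)
  show ?thesis
  proof (cases "i \<in> A \<or> Suc (\<nu> i) < d")
    case True
    have "level_monom (\<nu>(i := Suc (\<nu> i)), \<gamma>) \<in> (normal_span (Suc N) :: ((nat \<Rightarrow> 'a) \<Rightarrow> 'a) set)"
    proof (rule level_monom_in_normal_span)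
      show "(\<nu>(i := Suc (\<nu> i))) j \<le> Suc N" if "j \<in> A" for j
        using \<nu>A[OF that] by (cases "j = i") simp_all
      show "(\<nu>(i := Suc (\<nu> i))) j < d" if "j \<in> B" for j
        using \<nu>B[OF that] True that disjoint by auto
    qed (use \<gamma> in simp)
    then show ?thesis by (rule normal_span_cong) (simp only: upd eq)
  next
    case False
    then have iB: "i \<in> B" "i \<notin> A" using i union by blast+
    have d: "Suc (\<nu> i) = d" using \<nu>B[OF iB(1)] False by simp
    \<comment> \<open>The exponents of the term of \<open>x\<^sub>i\<^sup>d\<close> in which the factors of \<open>S\<close> contribute their root.\<close>
    define \<mu> where "\<mu> = (\<lambda>S j. if j \<in> S then Suc (\<nu> j) else if j = i then d - card S else \<nu> j)"
    have \<mu>: "level_monom (\<mu> S, \<gamma>) x = (\<Prod>a\<in>S. x a) * (x i ^ (d - card S) * R x)"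
      if S: "S \<subseteq> A" for S and x :: "nat \<Rightarrow> 'a"
    proof -
      have "x j ^ \<mu> S j = (if j \<in> S then x j else 1) * x j ^ (\<nu>(i := d - card S)) j" for j
        using S iB(2) unfolding \<mu>_def by auto
      then have "(\<Prod>j\<in>{1..2*d}. x j ^ \<mu> S j) =
          (\<Prod>j\<in>{1..2*d}. if j \<in> S then x j else 1) * (\<Prod>j\<in>{1..2*d}. x j ^ (\<nu>(i := d - card S)) j)"
        by (simp add: prod.distrib)
      also have "(\<Prod>j\<in>{1..2*d}. if j \<in> S then x j else 1) = (\<Prod>j\<in>S. x j)"
      proof -
        have "{1..2*d} \<inter> S = S" using S union by blast
        then show ?thesis by (simp flip: prod.inter_restrict)
      qed
      finally show ?thesis
        using upd[of "d - card S" x] unfolding level_monom_def by (simp add: mult.assoc)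
    qed
    have span_S: "(\<lambda>x. (-1) ^ card S * level_monom (\<mu> S, \<gamma>) x) \<in> (normal_span (Suc N) :: ((nat \<Rightarrow> 'a) \<Rightarrow> 'a) set)"
      if S: "S \<in> Pow A - {{}}" for S
    proof (rule normal_span_scale, rule level_monom_in_normal_span)
      show "\<mu> S j \<le> Suc N" if "j \<in> A" for j
        using \<nu>A[OF that] that iB(2) unfolding \<mu>_def by auto
      show "\<mu> S j < d" if "j \<in> B" for j
      proof -
        have "j \<notin> S" using S that disjoint by blast
        moreover have "card S > 0" using S finite_subset[OF _ finite_A] by (auto simp: card_gt_0_iff)
        ultimately show ?thesis using \<nu>B[OF that] d_pos unfolding \<mu>_def by auto
      qed
    qed (use \<gamma> in simp)
    have span_0: "level_monom (\<nu>(i := 0), Suc \<gamma>) \<in> (normal_span (Suc N) :: ((nat \<Rightarrow> 'a) \<Rightarrow> 'a) set)"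
    proof (rule level_monom_in_normal_span)
      show "(\<nu>(i := 0)) j \<le> Suc N" if "j \<in> A" for j
        using \<nu>A[OF that] by simp
      show "(\<nu>(i := 0)) j < d" if "j \<in> B" for j
        using \<nu>B[OF that] d_pos by simp
    qed (use \<gamma> in simp)
    have "(\<lambda>x. level_monom (\<nu>(i := 0), Suc \<gamma>) x +
        (-1) * (\<Sum>S\<in>Pow A - {{}}. (-1) ^ card S * level_monom (\<mu> S, \<gamma>) x)) \<in> (normal_span (Suc N) :: ((nat \<Rightarrow> 'a) \<Rightarrow> 'a) set)"
      by (intro normal_span_add[OF span_0] normal_span_scale normal_span_sum span_S)
    then show ?thesis
    proof (rule normal_span_cong)
      fix x :: "nat \<Rightarrow> 'a" assume x: "x \<in> split_conf"
      have "(\<Sum>S\<in>Pow A - {{}}. (-1) ^ card S * level_monom (\<mu> S, \<gamma>) x) =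
          (\<Sum>S\<in>Pow A - {{}}. (\<Prod>a\<in>S. - x a) * x i ^ (d - card S)) * R x"
        unfolding sum_distrib_right
      proof (rule sum.cong[OF refl])
        fix S assume "S \<in> Pow A - {{}}"
        then have "S \<subseteq> A" by blast
        then show "(-1) ^ card S * level_monom (\<mu> S, \<gamma>) x = (\<Prod>a\<in>S. - x a) * x i ^ (d - card S) * R x"
          by (simp add: \<mu> prod_uminus mult.assoc)
      qed
      moreover have "level_monom (\<nu>(i := 0), Suc \<gamma>) x = level x * R x"
        unfolding level_monom_upd[OF i] R_def by (simp add: mult_ac)
      moreover have "x i * level_monom (\<nu>, \<gamma>) x = x i ^ d * R x" unfolding eq d ..
      ultimately show "x i * level_monom (\<nu>, \<gamma>) x = level_monom (\<nu>(i := 0), Suc \<gamma>) x +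
          (-1) * (\<Sum>S\<in>Pow A - {{}}. (-1) ^ card S * level_monom (\<mu> S, \<gamma>) x)"
        unfolding power_d_reduce[OF x iB(1)] by (simp add: left_diff_distrib)
    qed
  qed
qed

lemma poly_fun_deg_in_normal_span:
  fixes f :: "(nat \<Rightarrow> 'a::field) \<Rightarrow> 'a"
  assumes "poly_fun_deg (2*d) N f"
  shows "f \<in> normal_span N"
  using assms
proof (induction rule: poly_fun_deg.induct)
  case (const N c)
  have "level_monom (\<lambda>_. 0, 0) \<in> (normal_span N :: ((nat \<Rightarrow> 'a) \<Rightarrow> 'a) set)"
    using d_pos by (intro level_monom_in_normal_span) simp_all
  from normal_span_scale[OF this, of c] show ?case
    by (rule normal_span_cong) (simp add: level_monom_def)
next
  case (coord_mult i N f)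
  obtain c where c: "\<forall>x\<in>split_conf. f x = (\<Sum>k\<in>normal_exponents N. c k * level_monom k x)"
    using coord_mult.IH unfolding normal_span_def by blast
  have "(\<lambda>x. c k * (x i * level_monom k x)) \<in> (normal_span (Suc N) :: ((nat \<Rightarrow> 'a) \<Rightarrow> 'a) set)"
    if "k \<in> normal_exponents N" for k
    using level_monom_coord_mult[of "fst k" "snd k" N i] that coord_mult.hyps(1)
    by (intro normal_span_scale) simp
  then have "(\<lambda>x. \<Sum>k\<in>normal_exponents N. c k * (x i * level_monom k x)) \<in>
      (normal_span (Suc N) :: ((nat \<Rightarrow> 'a) \<Rightarrow> 'a) set)"
    by (rule normal_span_sum)
  then show ?case
    by (rule normal_span_cong) (simp add: c sum_distrib_left mult.left_commute)
next
  case (add N f g)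
  then show ?case by (intro normal_span_add)
qed

lemma krull_dim_split_conf_le:
  "krull_dim (split_top :: (nat \<Rightarrow> 'a::field) topology) \<le> enat (d + 1)"
  unfolding krull_dim_def
proof (rule Sup_least)
  fix e assume "e \<in> {enat m | m. \<exists>Z :: nat \<Rightarrow> (nat \<Rightarrow> 'a) set.
     (\<forall>i\<le>m. closedin split_top (Z i) \<and> irreducible_space (subtopology split_top (Z i))) \<and>
     (\<forall>i<m. Z i \<subset> Z (Suc i))}"
  then have "\<exists>m. e = enat m \<and> (\<exists>Z :: nat \<Rightarrow> (nat \<Rightarrow> 'a) set.
     (\<forall>i\<le>m. closedin split_top (Z i) \<and> irreducible_space (subtopology split_top (Z i))) \<and>
     (\<forall>i<m. Z i \<subset> Z (Suc i)))" by (rule CollectD)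
  then obtain m where m: "e = enat m \<and> (\<exists>Z :: nat \<Rightarrow> (nat \<Rightarrow> 'a) set.
     (\<forall>i\<le>m. closedin split_top (Z i) \<and> irreducible_space (subtopology split_top (Z i))) \<and>
     (\<forall>i<m. Z i \<subset> Z (Suc i)))" ..
  note e = conjunct1[OF m]
  from conjunct2[OF m] obtain Z :: "nat \<Rightarrow> (nat \<Rightarrow> 'a) set" where
    "(\<forall>i\<le>m. closedin split_top (Z i) \<and> irreducible_space (subtopology split_top (Z i))) \<and>
     (\<forall>i<m. Z i \<subset> Z (Suc i))" ..
  then have Z:
    "\<And>i. i \<le> m \<Longrightarrow> closedin split_top (Z i :: (nat \<Rightarrow> 'a) set)"
    "\<And>i. i \<le> m \<Longrightarrow> irreducible_space (subtopology split_top (Z i))"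
    "\<And>i. i < m \<Longrightarrow> Z i \<subset> Z (Suc i)" by blast+
  obtain s where s: "s \<ge> 1" "\<And>N. independent_of_deg (2*d) (Z m) (s * N) ((N + m) choose m)"
    using chain_growth[where Z = Z and m = m and i = m, OF split_conf_sub Z order_refl] by blast
  have sub: "Z m \<subseteq> split_conf"
    using closedin_subset[OF Z(1)[OF order_refl]] unfolding topspace_split_top .
  have "(N + m) choose m \<le> d ^ d * (s * N + 1) ^ (d + 1)" for N
    unfolding card_normal_exponents[symmetric]
  proof (rule independent_of_deg_le_card[OF finite_normal_exponents _ s(2)])
    fix f :: "(nat \<Rightarrow> 'a) \<Rightarrow> 'a" assume "poly_fun_deg (2*d) (s * N) f"
    then have "f \<in> normal_span (s * N)" by (rule poly_fun_deg_in_normal_span)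
    then show "\<exists>c. \<forall>x\<in>Z m. f x = (\<Sum>k\<in>normal_exponents (s * N). c k * level_monom k x)"
      using sub unfolding normal_span_def by blast
  qed
  then have "m \<le> d + 1" using s(1) by (rule binomial_growth)
  then show "e \<le> enat (d + 1)" using e by simp
qed

end

section \<open>The theorem\<close>

lemma max_End_ge:
  fixes q :: "nat \<Rightarrow> 'a::field"
  assumes "q \<in> Conf n" "d < n"
  shows "card (End_deg n d q) \<le> max_End TYPE('a) n d"
  unfolding max_End_def using assms finite_End_counts[OF assms(2)] by (intro Max_ge) auto

theorem theorem1p5:
  fixes d :: nat and A B :: "nat set" and \<pi> :: "nat set set"
  assumes "d \<ge> 1"
    and "half_partition d \<pi>"
    and "\<pi> = {A, B}"
  shows
    "(\<forall>P Q. two_image_portrait d P \<and> two_image_portrait d Q \<and>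
        fiber_partition (2*d) P = \<pi> \<and> fiber_partition (2*d) Q = \<pi> \<longrightarrow>
          (Conf_portrait (2*d) P d :: (nat \<Rightarrow> 'k::field alg_closure) set)
             = Conf_portrait (2*d) Q d \<and>
          (Conf_portrait (2*d) P d :: (nat \<Rightarrow> 'k alg_closure) set) = Conf_partition \<pi> d \<and>
          (Moduli_portraits (2*d) P Q d :: (nat \<Rightarrow> 'k alg_closure) set set)
             = Moduli_partition \<pi> d)
     \<and>
     ((Conf_partition \<pi> d :: (nat \<Rightarrow> 'k alg_closure) set) =
        {q \<in> Conf (2*d). \<forall>k. 1 \<le> k \<and> k < d \<longrightarrow> elem_sym k A q = elem_sym k B q} \<and>
      closedin (subtopology (zariski (2*d)) (Conf (2*d)))
        (Conf_partition \<pi> d :: (nat \<Rightarrow> 'k alg_closure) set) \<and>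
      krull_dim (subtopology (zariski (2*d)) (Conf_partition \<pi> d :: (nat \<Rightarrow> 'k alg_closure) set))
        = enat (d + 1))
     \<and>
     ((\<forall>\<pi>'. half_partition d \<pi>' \<and> \<pi>' \<noteq> \<pi> \<longrightarrow>
         (rat_points (2*d) (Conf_partition \<pi> d) \<inter> rat_points (2*d) (Conf_partition \<pi>' d)
            :: (nat \<Rightarrow> 'K::field_char_0) set) = {}) \<and>
      (\<forall>P Q. two_image_portrait d P \<and> two_image_portrait d Q \<and>
         fiber_partition (2*d) P \<noteq> fiber_partition (2*d) Q \<longrightarrow>
         rat_orbits (2*d) (Moduli_portraits (2*d) P Q d :: (nat \<Rightarrow> 'K alg_closure) set set) = {}))
     \<and>
     ((\<forall>q \<in> (Conf_partition \<pi> d :: (nat \<Rightarrow> 'k alg_closure) set).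
         finite (End_deg (2*d) d q) \<and> card (End_deg (2*d) d q) \<ge> 2*d * (2*d - 1)) \<and>
      max_End TYPE('k alg_closure) (2*d) d \<ge> 2*d * (2*d - 1))"
proof -
  interpret split_indices d A B
    using assms by (intro split_indices_of_half_partition) simp_all
  have part: "Conf_partition \<pi> d = split_conf"
    unfolding assms(3) by (rule Conf_partition_eq_split_conf)
  have portrait: "Conf_portrait (2*d) P d = split_conf"
    if "two_image_portrait d P" "fiber_partition (2*d) P = \<pi>" for P
    using that unfolding assms(3) by (rule Conf_portrait_eq_split_conf)
  have split: "\<exists>C D. \<rho> = {C, D} \<and> split_indices d C D" if half: "half_partition d \<rho>" for \<rho>
  proof -
    obtain C D where "\<rho> = {C, D}"
      using half unfolding half_partition_def card_2_iff by blast
    moreover from this have "split_indices d C D"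
      using half by (intro split_indices_of_half_partition[OF assms(1)]) simp
    ultimately show ?thesis by blast
  qed
  have two: "(2 :: 'K alg_closure) \<noteq> 0" by simp
  have disjoint_char_0: "Conf_portrait (2*d) P d \<inter> Conf_portrait (2*d) Q d = ({} :: (nat \<Rightarrow> 'K alg_closure) set)"
    if PQ: "two_image_portrait d P" "two_image_portrait d Q"
      "fiber_partition (2*d) P \<noteq> fiber_partition (2*d) Q" for P Q
  proof (rule equals0I)
    fix q :: "nat \<Rightarrow> 'K alg_closure"
    assume q: "q \<in> Conf_portrait (2*d) P d \<inter> Conf_portrait (2*d) Q d"
    have half: "half_partition d (fiber_partition (2*d) P)" "half_partition d (fiber_partition (2*d) Q)"
      using PQ unfolding two_image_portrait_def by blast+
    obtain C D where C: "fiber_partition (2*d) P = {C, D}" "split_indices d C D"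
      using split[OF half(1)] by blast
    obtain C' D' where C': "fiber_partition (2*d) Q = {C', D'}" "split_indices d C' D'"
      using split[OF half(2)] by blast
    have "q \<in> split_indices.split_conf d C D" "q \<in> split_indices.split_conf d C' D'"
      using q split_indices.Conf_portrait_eq_split_conf[OF C(2) PQ(1) C(1)]
        split_indices.Conf_portrait_eq_split_conf[OF C'(2) PQ(2) C'(1)] by blast+
    then have "{C, D} = {C', D'}"
      by (rule split_conf_disjoint[OF two C(2) C'(2)])
    then show False using PQ(3) C(1) C'(1) by simp
  qed
  have rat: "(rat_points (2*d) (Conf_partition \<pi> d) \<inter> rat_points (2*d) (Conf_partition \<pi>' d)
            :: (nat \<Rightarrow> 'K) set) = {}" if other: "half_partition d \<pi>'" "\<pi>' \<noteq> \<pi>" for \<pi>'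
  proof -
    obtain C D where C: "\<pi>' = {C, D}" "split_indices d C D" using split[OF other(1)] by blast
    have eq: "Conf_partition \<pi>' d = split_indices.split_conf d C D"
      unfolding C(1) by (rule split_indices.Conf_partition_eq_split_conf[OF C(2)])
    have "False" if q: "q \<in> Conf_partition \<pi> d" "q \<in> Conf_partition \<pi>' d" for q :: "nat \<Rightarrow> 'K alg_closure"
    proof -
      have "{A, B} = {C, D}"
        by (rule split_conf_disjoint[OF two split_indices_axioms C(2) q[unfolded part eq]])
      then show False using \<open>\<pi>' \<noteq> \<pi>\<close> C(1) assms(3) by simp
    qed
    then show ?thesis unfolding rat_points_def by blast
  qed
  have dim: "krull_dim (split_top :: (nat \<Rightarrow> 'k alg_closure) topology) = enat (d + 1)"
    by (rule antisym[OF krull_dim_split_conf_le krull_dim_split_conf_ge])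
  have End: "finite (End_deg (2*d) d q) \<and> card (End_deg (2*d) d q) \<ge> 2*d * (2*d - 1)"
    if "q \<in> split_conf" for q :: "nat \<Rightarrow> 'k alg_closure"
  proof
    have "q \<in> Conf (2*d)" using that unfolding split_conf_def by blast
    then show "finite (End_deg (2*d) d q)" by (rule End_deg_bound(1)) (use d_pos in simp)
  qed (rule card_End_deg_ge[OF that])
  obtain q :: "nat \<Rightarrow> 'k alg_closure" where q: "q \<in> split_conf" using split_conf_nonempty by blast
  then have "q \<in> Conf (2*d)" unfolding split_conf_def by blast
  then have "card (End_deg (2*d) d q) \<le> max_End TYPE('k alg_closure) (2*d) d"
    by (rule max_End_ge) (use d_pos in simp)
  then have max: "max_End TYPE('k alg_closure) (2*d) d \<ge> 2*d * (2*d - 1)"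
    using card_End_deg_ge[OF q] by linarith
  show ?thesis
  proof (intro conjI allI impI ballI)
    fix P Q assume PQ: "two_image_portrait d P \<and> two_image_portrait d Q \<and>
        fiber_partition (2*d) P = \<pi> \<and> fiber_partition (2*d) Q = \<pi>"
    have P: "Conf_portrait (2*d) P d = (split_conf :: (nat \<Rightarrow> 'k alg_closure) set)"
      and Q: "Conf_portrait (2*d) Q d = (split_conf :: (nat \<Rightarrow> 'k alg_closure) set)"
      using PQ portrait by blast+
    show "(Conf_portrait (2*d) P d :: (nat \<Rightarrow> 'k alg_closure) set) = Conf_portrait (2*d) Q d"
      "(Conf_portrait (2*d) P d :: (nat \<Rightarrow> 'k alg_closure) set) = Conf_partition \<pi> d"
      "(Moduli_portraits (2*d) P Q d :: (nat \<Rightarrow> 'k alg_closure) set set) = Moduli_partition \<pi> d"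
      unfolding Moduli_portraits_def Moduli_partition_def P Q part by simp_all
  next
    show "(Conf_partition \<pi> d :: (nat \<Rightarrow> 'k alg_closure) set) =
        {q \<in> Conf (2*d). \<forall>k. 1 \<le> k \<and> k < d \<longrightarrow> elem_sym k A q = elem_sym k B q}"
      unfolding part by (rule split_conf_eq_elem_sym)
    show "closedin (subtopology (zariski (2*d)) (Conf (2*d)))
        (Conf_partition \<pi> d :: (nat \<Rightarrow> 'k alg_closure) set)"
      unfolding part by (rule closedin_split_conf)
    show "krull_dim (subtopology (zariski (2*d)) (Conf_partition \<pi> d :: (nat \<Rightarrow> 'k alg_closure) set))
        = enat (d + 1)"
      unfolding part by (rule dim)
  next
    fix \<pi>' assume "half_partition d \<pi>' \<and> \<pi>' \<noteq> \<pi>"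
    then show "(rat_points (2*d) (Conf_partition \<pi> d) \<inter> rat_points (2*d) (Conf_partition \<pi>' d)
            :: (nat \<Rightarrow> 'K) set) = {}" using rat by blast
  next
    fix P Q assume "two_image_portrait d P \<and> two_image_portrait d Q \<and>
         fiber_partition (2*d) P \<noteq> fiber_partition (2*d) Q"
    then have "Conf_portrait (2*d) P d \<inter> Conf_portrait (2*d) Q d = ({} :: (nat \<Rightarrow> 'K alg_closure) set)"
      using disjoint_char_0 by blast
    then show "rat_orbits (2*d) (Moduli_portraits (2*d) P Q d :: (nat \<Rightarrow> 'K alg_closure) set set) = {}"
      unfolding rat_orbits_def Moduli_portraits_def aff_quotient_def by simp
  next
    fix q :: "nat \<Rightarrow> 'k alg_closure" assume "q \<in> Conf_partition \<pi> d"
    then have "q \<in> split_conf" unfolding part .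
    then show "finite (End_deg (2*d) d q)" "card (End_deg (2*d) d q) \<ge> 2*d * (2*d - 1)"
      using End by blast+
  qed (rule max)
qed

end
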